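(* Consider the system of ordinary differential equations, for $i\in\{1,\ldots,n\}$ and $t\ge0$, $$\begin{aligned} \dot X_i &= -A_{vi}^{\rm T}(A_{vi}X_i-Y_i^{vi})-A_{vi}^{\rm T}\Lambda^3_i-\sum_{j=1}^n a_{i,j}(\Lambda^1_i-\Lambda^1_j)-\sum_{j=1}^n a_{i,j}(X_i-X_j),\\ \dot Y_i &= -(Y_iB_{li}-F_{li})B_{li}^{\rm T}+[I_{m_i}]_{\rm R}\Lambda^3_i+[I_{m_i}]_{\rm R}(A_{vi}X_i-Y_i^{vi})-\sum_{j=1}^n a_{i,j}(Y_i-Y_j)-\sum_{j=1}^n a_{i,j}(\Lambda^2_i-\Lambda^2_j),\\ \dot\Lambda^1_i &= \sum_{j=1}^n a_{i,j}(X_i-X_j),\qquad \dot\Lambda^2_i = \sum_{j=1}^n a_{i,j}(Y_i-Y_j),\qquad \dot\Lambda^3_i = A_{vi}X_i-Y_i^{vi}, \end{aligned}$$ with state variables $X_i\in\mathbb R^{r\times p}$, $Y_i\in\mathbb R^{m\times p}$, $\Lambda^1_i\in\mathbb R^{r\times p}$, $\Lambda^2_i\in\mathbb R^{m\times p}$, $\Lambda^3_i\in\mathbb R^{m_i\times p}$ and arbitrary initial conditions. If the undirected graph $\mathcal G$ is connected, then: 1) every equilibrium of this system is Lyapunov stable, and its trajectory is bounded for any initial condition; 2) the trajectory of this system is exponentially convergent, and $X_i(t)$ converges exponentially to a least squares solution to $AXB=F$ for all $i\in\{1,\ldots,n\}$.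
   Context: $A\in\mathbb R^{m\times r}$, $B\in\mathbb R^{p\times q}$, $F\in\mathbb R^{m\times q}$ are partitioned (Row-Column-Column structure) as $A=[A_{v1}^{\rm T},\ldots,A_{vn}^{\rm T}]^{\rm T}$, $B=[B_{l1},\ldots,B_{ln}]$, $F=[F_{l1},\ldots,F_{ln}]$ with $A_{vi}\in\mathbb R^{m_i\times r}$, $B_{li}\in\mathbb R^{p\times q_i}$, $F_{li}\in\mathbb R^{m\times q_i}$, $\sum_i m_i=m$, $\sum_i q_i=q$. Each $Y_i\in\mathbb R^{m\times p}$ is partitioned into row-blocks $Y_i=[(Y_i^{v1})^{\rm T},\ldots,(Y_i^{vn})^{\rm T}]^{\rm T}$, $Y_i^{vj}\in\mathbb R^{m_j\times p}$. $[I_{m_i}]_{\rm R}\in\mathbb R^{m\times m_i}$ is the matrix whose $i$th row-block (with respect to the row partition $m_1,\ldots,m_n$) is $I_{m_i}$ and whose other row-blocks are zero. $\mathcal G$ is an undirected graph on $\{1,\ldots,n\}$ with symmetric adjacency matrix $[a_{i,j}]$, $a_{i,j}=a_{j,i}>0$ if $\{j,i\}$ is an edge and $a_{i,j}=0$ otherwise. A least squares solution to $AXB=F$ is a minimizer of $\|AXB-F\|_{\rm F}^2$ over $X\in\mathbb R^{r\times p}$. An equilibrium $z$ is Lyapunov stable if for every $\epsilon>0$ there is $\delta>0$ such that every solution starting in the open ball of radius $\delta$ about $z$ stays in the open ball of radius $\epsilon$ about $z$ for all $t\ge0$. A trajectory converges exponentially to $z^*$ if its distance to $z^*$ is at most $c\,e^{-\mu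 t}$ for some $c\ge0$, $\mu>0$ and all $t\ge0$; "exponentially convergent" means converging exponentially to some equilibrium (possibly depending on the initial condition). *)

theory Defs
  imports Complex_Main "Jordan_Normal_Form.Matrix"
begin

section \<open>Block-partitioned matrices\<close>

text \<open>Agents are numbered \<open>0, \<dots>, n - 1\<close>, and rows and columns of matrices are numbered from 0 as
  usual for the matrix type.  A partition of the rows (columns) into consecutive blocks is given by
  the block sizes \<open>ms i\<close> (\<open>qs i\<close>), \<open>i < n\<close>; block \<open>i\<close> starts at index \<open>\<Sum>j<i. ms j\<close>.\<close>

definition row_block :: "(nat \<Rightarrow> nat) \<Rightarrow> real mat \<Rightarrow> nat \<Rightarrow> real mat" where
  "row_block ms M i = mat (ms i) (dim_col M) (\<lambda>(k, l). M $$ ((\<Sum>j<i. ms j) + k, l))"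

definition col_block :: "(nat \<Rightarrow> nat) \<Rightarrow> real mat \<Rightarrow> nat \<Rightarrow> real mat" where
  "col_block qs M i = mat (dim_row M) (qs i) (\<lambda>(k, l). M $$ (k, (\<Sum>j<i. qs j) + l))"

text \<open>The matrix \<open>[I]\<^sub>R\<close> with \<open>n\<close> row-blocks, of which the \<open>i\<close>th is the identity and the others are
  zero; see \<open>row_block_id_row_block\<close>.\<close>

definition id_row_block :: "nat \<Rightarrow> (nat \<Rightarrow> nat) \<Rightarrow> nat \<Rightarrow> real mat" where
  "id_row_block n ms i =
     mat (\<Sum>j<n. ms j) (ms i) (\<lambda>(k, l). if k = (\<Sum>j<i. ms j) + l then 1 else 0)"

lemma block_end_le:
  fixes ms :: "nat \<Rightarrow> nat"
  assumes "i < j"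
  shows "(\<Sum>k<i. ms k) + ms i \<le> (\<Sum>k<j. ms k)"
proof -
  have "(\<Sum>k<Suc i. ms k) \<le> (\<Sum>k<j. ms k)"
    by (rule sum_mono2) (use assms in auto)
  then show ?thesis by simp
qed

lemma row_block_id_row_block:
  assumes "i < n" "j < n"
  shows "row_block ms (id_row_block n ms i) j = (if j = i then 1\<^sub>m (ms i) else 0\<^sub>m (ms j) (ms i))"
proof (rule eq_matI)
  fix k l
  assume "k < dim_row (if j = i then 1\<^sub>m (ms i) else 0\<^sub>m (ms j) (ms i) :: real mat)"
    and "l < dim_col (if j = i then 1\<^sub>m (ms i) else 0\<^sub>m (ms j) (ms i) :: real mat)"
  then have kl: "k < ms j" "l < ms i"
    by (auto split: if_splits)
  have "(\<Sum>h<j. ms h) + k < (\<Sum>h<n. ms h)"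
    using block_end_le[OF assms(2), of ms] kl by linarith
  moreover have "(\<Sum>h<j. ms h) + k \<noteq> (\<Sum>h<i. ms h) + l" if "j \<noteq> i"
    using that block_end_le[of i j ms] block_end_le[of j i ms] kl by linarith
  ultimately show "row_block ms (id_row_block n ms i) j $$ (k, l) =
      (if j = i then 1\<^sub>m (ms i) else 0\<^sub>m (ms j) (ms i)) $$ (k, l)"
    using kl by (auto simp: row_block_def id_row_block_def)
qed (auto simp: row_block_def id_row_block_def)

definition frobenius_norm :: "real mat \<Rightarrow> real" where
  "frobenius_norm M = sqrt (\<Sum>k<dim_row M. \<Sum>l<dim_col M. (M $$ (k, l))\<^sup>2)"

definition least_squares_solution :: "real mat \<Rightarrow> real mat \<Rightarrow> real mat \<Rightarrow> real mat \<Rightarrow> bool" where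
  "least_squares_solution A B F X \<longleftrightarrow>
     X \<in> carrier_mat (dim_col A) (dim_row B) \<and>
     (\<forall>Z \<in> carrier_mat (dim_col A) (dim_row B).
        (frobenius_norm (A * X * B - F))\<^sup>2 \<le> (frobenius_norm (A * Z * B - F))\<^sup>2)"


section \<open>Weighted undirected graphs\<close>

definition undirected_graph :: "'a set \<Rightarrow> 'a set set \<Rightarrow> bool" where
  "undirected_graph V E \<longleftrightarrow> (\<forall>e \<in> E. \<exists>u \<in> V. \<exists>v \<in> V. u \<noteq> v \<and> e = {u, v})"

definition connected_graph :: "'a set \<Rightarrow> 'a set set \<Rightarrow> bool" where
  "connected_graph V E \<longleftrightarrow>
     V \<noteq> {} \<and> (\<forall>u \<in> V. \<forall>v \<in> V. (u, v) \<in> {(x, y). {x, y} \<in> E}\<^sup>*)"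

definition weighted_adjacency_matrix :: "nat \<Rightarrow> nat set set \<Rightarrow> real mat \<Rightarrow> bool" where
  "weighted_adjacency_matrix n E a \<longleftrightarrow>
     a \<in> carrier_mat n n \<and>
     (\<forall>i<n. \<forall>j<n. a $$ (i, j) = a $$ (j, i) \<and>
        (if {j, i} \<in> E then a $$ (i, j) > 0 else a $$ (i, j) = 0))"


section \<open>The dynamical system\<close>

text \<open>The fields hold the families \<open>X\<^sub>i, Y\<^sub>i, \<Lambda>\<^sup>1\<^sub>i, \<Lambda>\<^sup>2\<^sub>i, \<Lambda>\<^sup>3\<^sub>i\<close>; only members with \<open>i\<close> below the number
  of agents are constrained or observed.\<close>

record net_state =
  sX :: "nat \<Rightarrow> real mat"
  sY :: "nat \<Rightarrow> real mat"
  sL1 :: "nat \<Rightarrow> real mat"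
  sL2 :: "nat \<Rightarrow> real mat"
  sL3 :: "nat \<Rightarrow> real mat"

definition states :: "nat \<Rightarrow> (nat \<Rightarrow> nat) \<Rightarrow> nat \<Rightarrow> nat \<Rightarrow> net_state set" where
  "states n ms r p = {s. \<forall>i<n.
     sX s i \<in> carrier_mat r p \<and>
     sY s i \<in> carrier_mat (\<Sum>j<n. ms j) p \<and>
     sL1 s i \<in> carrier_mat r p \<and>
     sL2 s i \<in> carrier_mat (\<Sum>j<n. ms j) p \<and>
     sL3 s i \<in> carrier_mat (ms i) p}"

definition state_diff :: "net_state \<Rightarrow> net_state \<Rightarrow> net_state" where
  "state_diff s s' =
     \<lparr> sX = (\<lambda>i. sX s i - sX s' i), sY = (\<lambda>i. sY s i - sY s' i),
       sL1 = (\<lambda>i. sL1 s i - sL1 s' i), sL2 = (\<lambda>i. sL2 s i - sL2 s' i),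
       sL3 = (\<lambda>i. sL3 s i - sL3 s' i) \<rparr>"

definition state_norm :: "nat \<Rightarrow> net_state \<Rightarrow> real" where
  "state_norm n s = sqrt (\<Sum>i<n.
     (frobenius_norm (sX s i))\<^sup>2 + (frobenius_norm (sY s i))\<^sup>2 +
     (frobenius_norm (sL1 s i))\<^sup>2 + (frobenius_norm (sL2 s i))\<^sup>2 + (frobenius_norm (sL3 s i))\<^sup>2)"

definition state_dist :: "nat \<Rightarrow> net_state \<Rightarrow> net_state \<Rightarrow> real" where
  "state_dist n s s' = state_norm n (state_diff s s')"

text \<open>The matrix \<open>\<Sum>j. a\<^sub>i\<^sub>j (Z\<^sub>i - Z\<^sub>j)\<close>, where all \<open>Z\<^sub>j\<close> have the same dimensions; matrices of
  varying dimensions have no library \<open>sum\<close>, so the sum is taken entrywise.\<close>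

definition coupling :: "real mat \<Rightarrow> (nat \<Rightarrow> real mat) \<Rightarrow> nat \<Rightarrow> real mat" where
  "coupling a Z i = mat (dim_row (Z i)) (dim_col (Z i))
     (\<lambda>(k, l). \<Sum>j<dim_row a. a $$ (i, j) * (Z i $$ (k, l) - Z j $$ (k, l)))"

definition vector_field ::
  "nat \<Rightarrow> (nat \<Rightarrow> nat) \<Rightarrow> (nat \<Rightarrow> nat) \<Rightarrow> real mat \<Rightarrow> real mat \<Rightarrow> real mat \<Rightarrow> real mat \<Rightarrow>
     net_state \<Rightarrow> net_state" where
  "vector_field n ms qs A B F a s =
     (let X = sX s; Y = sY s; \<Lambda>1 = sL1 s; \<Lambda>2 = sL2 s; \<Lambda>3 = sL3 s;
          Av = row_block ms A; Bl = col_block qs B; Fl = col_block qs F;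
          I\<^sub>R = id_row_block n ms;
          res = (\<lambda>i. Av i * X i - row_block ms (Y i) i)
      in \<lparr> sX = (\<lambda>i. - (transpose_mat (Av i) * res i) - transpose_mat (Av i) * \<Lambda>3 i
                     - coupling a \<Lambda>1 i - coupling a X i),
           sY = (\<lambda>i. - ((Y i * Bl i - Fl i) * transpose_mat (Bl i)) + I\<^sub>R i * \<Lambda>3 i
                     + I\<^sub>R i * res i - coupling a Y i - coupling a \<Lambda>2 i),
           sL1 = (\<lambda>i. coupling a X i),
           sL2 = (\<lambda>i. coupling a Y i),
           sL3 = res \<rparr>)"

definition has_mat_derivative ::
  "(real \<Rightarrow> real mat) \<Rightarrow> real mat \<Rightarrow> real filter \<Rightarrow> bool" where
  "has_mat_derivative f D net \<longleftrightarrow>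
     (\<forall>k<dim_row D. \<forall>l<dim_col D. ((\<lambda>t. f t $$ (k, l)) has_real_derivative D $$ (k, l)) net)"

text \<open>The following notions are for an arbitrary vector field \<open>f\<close> on the state space \<open>S\<close> of \<open>n\<close>
  agents.  At time 0 the derivative is one-sided.\<close>

definition is_solution ::
  "nat \<Rightarrow> net_state set \<Rightarrow> (net_state \<Rightarrow> net_state) \<Rightarrow> (real \<Rightarrow> net_state) \<Rightarrow> bool" where
  "is_solution n S f x \<longleftrightarrow>
     (\<forall>t\<ge>0. x t \<in> S) \<and>
     (\<forall>t\<ge>0. \<forall>i<n.
        has_mat_derivative (\<lambda>\<tau>. sX (x \<tau>) i) (sX (f (x t)) i) (at t within {0..}) \<and>
        has_mat_derivative (\<lambda>\<tau>. sY (x \<tau>) i) (sY (f (x t)) i) (at t within {0..}) \<and>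
        has_mat_derivative (\<lambda>\<tau>. sL1 (x \<tau>) i) (sL1 (f (x t)) i) (at t within {0..}) \<and>
        has_mat_derivative (\<lambda>\<tau>. sL2 (x \<tau>) i) (sL2 (f (x t)) i) (at t within {0..}) \<and>
        has_mat_derivative (\<lambda>\<tau>. sL3 (x \<tau>) i) (sL3 (f (x t)) i) (at t within {0..}))"

definition zero_mat_like :: "real mat \<Rightarrow> real mat" where
  "zero_mat_like M = 0\<^sub>m (dim_row M) (dim_col M)"

definition is_equilibrium ::
  "nat \<Rightarrow> net_state set \<Rightarrow> (net_state \<Rightarrow> net_state) \<Rightarrow> net_state \<Rightarrow> bool" where
  "is_equilibrium n S f z \<longleftrightarrow>
     z \<in> S \<and>
     (\<forall>i<n. sX (f z) i = zero_mat_like (sX z i) \<and>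
            sY (f z) i = zero_mat_like (sY z i) \<and>
            sL1 (f z) i = zero_mat_like (sL1 z i) \<and>
            sL2 (f z) i = zero_mat_like (sL2 z i) \<and>
            sL3 (f z) i = zero_mat_like (sL3 z i))"

definition lyapunov_stable ::
  "nat \<Rightarrow> net_state set \<Rightarrow> (net_state \<Rightarrow> net_state) \<Rightarrow> net_state \<Rightarrow> bool" where
  "lyapunov_stable n S f z \<longleftrightarrow>
     (\<forall>\<epsilon>>0. \<exists>\<delta>>0. \<forall>x. is_solution n S f x \<and> state_dist n (x 0) z < \<delta> \<longrightarrow>
        (\<forall>t\<ge>0. state_dist n (x t) z < \<epsilon>))"

definition bounded_trajectory :: "nat \<Rightarrow> (real \<Rightarrow> net_state) \<Rightarrow> bool" where
  "bounded_trajectory n x \<longleftrightarrow> (\<exists>c. \<forall>t\<ge>0. state_norm n (x t) \<le> c)"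

definition exponentially_decaying :: "(real \<Rightarrow> real) \<Rightarrow> bool" where
  "exponentially_decaying d \<longleftrightarrow> (\<exists>c\<ge>0. \<exists>\<mu>>0. \<forall>t\<ge>0. d t \<le> c * exp (- \<mu> * t))"

definition exponentially_convergent ::
  "nat \<Rightarrow> net_state set \<Rightarrow> (net_state \<Rightarrow> net_state) \<Rightarrow> (real \<Rightarrow> net_state) \<Rightarrow> bool" where
  "exponentially_convergent n S f x \<longleftrightarrow>
     (\<exists>z. is_equilibrium n S f z \<and> exponentially_decaying (\<lambda>t. state_dist n (x t) z))"

end

theory Submission
  imports Defs "HOL-Analysis.Derivative" "HOL-Library.Poly_Mapping"
begin

text \<open>With \<open>w = (X, Y)\<close> and \<open>l = (\<Lambda>\<^sup>1, \<Lambda>\<^sup>2, \<Lambda>\<^sup>3)\<close> the system is the saddle-point flow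
  \<open>w' = b - H w - K\<^sup>T l\<close>, \<open>l' = K w\<close> of an augmented Lagrangian, with \<open>H\<close> symmetric positive
  semidefinite and \<open>|K w|\<^sup>2\<close> bounded by a multiple of \<open>w \<bullet> H w\<close>.  The distance to any equilibrium does
  not increase, which gives stability and boundedness.  The linear part \<open>M\<close> and its transpose have the
  same kernel, so the state space splits orthogonally into \<open>ker M\<close>, along which nothing moves, and
  \<open>range M\<close>, on which \<open>|z|\<^sup>2 / 2 + \<epsilon> (w \<bullet> K\<^sup>T l)\<close> is a strict quadratic Lyapunov function.  At an
  equilibrium \<open>w\<close> is feasible (consensus and \<open>A X = Y\<close>) and the multipliers make the gradient of
  \<open>|Y B - F|\<^sup>2\<close> orthogonal to the feasible directions, so \<open>X\<close> is a least squares solution.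

  The dimensions are term parameters, so the states are embedded into inner product spaces of finitely
  supported functions, on which all operators have finite rank.\<close>

section \<open>Finite-rank operators on inner product spaces\<close>

text \<open>The ambient spaces are infinite-dimensional, so finite dimension is expressed through
  the range alone; \<open>f\<close> may be any map, and linearity enters separately.\<close>

definition finite_rank :: "('a \<Rightarrow> 'b::real_vector) \<Rightarrow> bool" where
  "finite_rank f \<longleftrightarrow> (\<exists>S. finite S \<and> (\<forall>x. f x \<in> span S))"

lemma finite_rank_compose: "finite_rank f \<Longrightarrow> finite_rank (\<lambda>x. f (g x))"
  by (auto simp: finite_rank_def)

lemma finite_rank_compose_linear:
  assumes "linear g" and "finite_rank f"
  shows "finite_rank (\<lambda>x. g (f x))"
proof -
  obtain S where S: "finite S" "\<And>x. f x \<in> span S"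
    using assms(2) by (auto simp: finite_rank_def)
  have "g (f x) \<in> span (g ` S)" for x
    unfolding linear_span_image[OF assms(1)] by (rule imageI) (rule S(2))
  with S(1) show ?thesis
    unfolding finite_rank_def by (intro exI[of _ "g ` S"]) simp
qed

lemma finite_rank_add:
  assumes "finite_rank f" and "finite_rank g"
  shows "finite_rank (\<lambda>x. f x + g x)"
proof -
  obtain S T where S: "finite S" "\<And>x. f x \<in> span S" and T: "finite T" "\<And>x. g x \<in> span T"
    using assms by (auto simp: finite_rank_def)
  have "f x \<in> span (S \<union> T)" "g x \<in> span (S \<union> T)" for x
    using S(2)[of x] T(2)[of x] span_mono[of S "S \<union> T"] span_mono[of T "S \<union> T"] by auto
  then have "f x + g x \<in> span (S \<union> T)" for x
    by (intro span_add)
  with S(1) T(1) show ?thesis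
    unfolding finite_rank_def by (intro exI[of _ "S \<union> T"]) simp
qed

lemma finite_rank_uminus: "finite_rank f \<Longrightarrow> finite_rank (\<lambda>x. - f x)"
  by (auto simp: finite_rank_def intro: span_neg)

lemma finite_rank_diff:
  assumes "finite_rank f" and "finite_rank g"
  shows "finite_rank (\<lambda>x. f x - g x)"
  using finite_rank_add[OF assms(1) finite_rank_uminus[OF assms(2)]] by simp

lemma finite_rank_Pair:
  assumes "finite_rank f" and "finite_rank g"
  shows "finite_rank (\<lambda>x. (f x, g x))"
proof -
  \<comment> \<open>The pair is the sum of \<open>(f x, 0)\<close> and
    \<open>(0, g x)\<close>.\<close>
  have "linear (\<lambda>x. (x, 0))" "linear (\<lambda>x. (0, x))"
    by (auto intro!: linearI)
  then show ?thesis
    using finite_rank_add[OF finite_rank_compose_linear[of "\<lambda>x. (x, 0)", OF _ assms(1)]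
        finite_rank_compose_linear[of "\<lambda>x. (0, x)", OF _ assms(2)]] by simp
qed

section \<open>Adjoints and orthogonal projections\<close>

lemma linear_of_adjoint:
  fixes f :: "'a::real_inner \<Rightarrow> 'b::real_inner"
  assumes "\<And>x y. inner (f x) y = inner x (g y)"
  shows "linear f"
proof (rule linearI)
  \<comment> \<open>The inner product separates points, and \<open>inner x (g y)\<close> is linear
    in \<open>x\<close>.\<close>
  show "f (x + y) = f x + f y" for x y
    by (subst vector_eq_rdot[symmetric]) (simp add: assms inner_add_left)
  show "f (c *\<^sub>R x) = c *\<^sub>R f x" for c x
    by (subst vector_eq_rdot[symmetric]) (simp add: assms)
qed

text \<open>A maximal independent subset of \<open>V\<close> is finite because it lies in
  \<open>span S\<close>; Gram-Schmidt then replaces it by an orthogonal set.\<close>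

lemma finite_dim_orthogonal_basis:
  fixes V :: "'a::real_inner set"
  assumes V: "subspace V" and S: "finite S" "V \<subseteq> span S"
  obtains C where "finite C" "C \<subseteq> V" "span C = V" "pairwise orthogonal C"
proof -
  obtain B where B: "B \<subseteq> V" "independent B" "V \<subseteq> span B"
    by (rule maximal_independent_subset)
  have "finite B"
    using independent_span_bound[OF S(1) B(2)] B(1) S(2) by (meson subset_trans)
  then obtain C where C: "finite C" "span C = span B" "pairwise orthogonal C"
    using basis_orthogonal[of B] by metis
  have "span B = V"
    using B(3) span_minimal[OF B(1) V] by blast
  with C show ?thesis
    using that[of C] span_superset[of C] by simp
qed

text \<open>Fourier expansion with unnormalized vectors: the orthogonal projection onto
  \<open>span C\<close> when \<open>C\<close> is finite and pairwise orthogonal. A zero vector in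
  \<open>C\<close> contributes nothing.\<close>

definition orth_proj :: "'a::real_inner set \<Rightarrow> 'a \<Rightarrow> 'a" where
  "orth_proj C v = (\<Sum>c\<in>C. (inner v c / inner c c) *\<^sub>R c)"

lemma orth_proj_orthogonal:
  fixes C :: "'a::real_inner set"
  assumes C: "finite C" "pairwise orthogonal C" and y: "y \<in> span C"
  shows "inner (v - orth_proj C v) y = 0"
proof -
  have "inner (orth_proj C v) d = inner v d" if d: "d \<in> C" for d
  proof -
    \<comment> \<open>By orthogonality only the summand at \<open>c = d\<close> survives; for
      \<open>d = 0\<close> it is 0, as is \<open>inner v d\<close>.\<close>
    have "inner (orth_proj C v) d = (\<Sum>c\<in>C. if c = d then inner v d else 0)"
      unfolding orth_proj_def inner_sum_left
      using C(2) d by (intro sum.cong) (auto simp: pairwise_def orthogonal_def)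
    then show ?thesis using C(1) d by simp
  qed
  then have "\<And>c. c \<in> C \<Longrightarrow> orthogonal (v - orth_proj C v) c"
    by (simp add: orthogonal_def inner_diff_left)
  then show ?thesis
    using orthogonal_to_span[OF y] by (simp add: orthogonal_def)
qed

lemma orth_proj_in_span: "orth_proj C v \<in> span C"
  unfolding orth_proj_def by (intro span_sum span_scale span_base)

text \<open>\<open>y - orth_proj C y\<close> lies in the span and is orthogonal to it, hence to
  itself.\<close>

lemma orth_proj_id:
  assumes C: "finite C" "pairwise orthogonal C" and y: "y \<in> span C"
  shows "orth_proj C y = y"
proof -
  have "y - orth_proj C y \<in> span C"
    using y orth_proj_in_span span_diff by blast
  then show ?thesis
    using orth_proj_orthogonal[OF C, of "y - orth_proj C y" y] by simp
qed

text \<open>Plays the part of a matrix and its transpose. The adjoint is a datum, since on an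
  incomplete space even a finite-rank linear map can lack one.\<close>

locale finite_rank_adjoint =
  fixes f :: "'a::real_inner \<Rightarrow> 'b::real_inner" and f' :: "'b \<Rightarrow> 'a"
  assumes adjoint: "inner (f x) y = inner x (f' y)"
    and finite_rank: "finite_rank f"
begin

lemma linear: "linear f"
  by (rule linear_of_adjoint) (rule adjoint)

lemma range_orthogonal_basis:
  obtains C where "finite C" "span C = range f" "pairwise orthogonal C"
proof -
  obtain S where "finite S" "range f \<subseteq> span S"
    using finite_rank by (auto simp: finite_rank_def)
  moreover have "subspace (range f)"
    using linear_subspace_image[OF linear] by (simp add: subspace_UNIV)
  ultimately show ?thesis
    using finite_dim_orthogonal_basis that by metis
qed

text \<open>Over an orthogonal spanning set \<open>C\<close> of the range, the coefficient of
  \<open>f x\<close> at \<open>c\<close> is \<open>inner x (f' c) / inner c c\<close>, which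
  Cauchy-Schwarz bounds by a multiple of \<open>norm x\<close>.\<close>

lemma bounded_linear: "bounded_linear f"
proof -
  obtain C where C: "finite C" "span C = range f" "pairwise orthogonal C"
    by (rule range_orthogonal_basis)
  have "norm (f x) \<le> norm x * (\<Sum>c\<in>C. norm (f' c) / inner c c * norm c)" for x
  proof -
    have "f x = orth_proj C (f x)"
      using orth_proj_id[OF C(1,3)] C(2) by auto
    also have "\<dots> = (\<Sum>c\<in>C. (inner x (f' c) / inner c c) *\<^sub>R c)"
      by (simp add: orth_proj_def adjoint)
    also have "norm \<dots> \<le> (\<Sum>c\<in>C. norm x * (norm (f' c) / inner c c * norm c))"
    proof (rule sum_norm_le)
      fix c
      have "norm ((inner x (f' c) / inner c c) *\<^sub>R c) = \<bar>inner x (f' c)\<bar> / inner c c * norm c"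
        by simp
      also have "\<dots> \<le> (norm x * norm (f' c)) / inner c c * norm c"
        by (intro mult_right_mono divide_right_mono Cauchy_Schwarz_ineq2) auto
      finally show "norm ((inner x (f' c) / inner c c) *\<^sub>R c)
          \<le> norm x * (norm (f' c) / inner c c * norm c)" by simp
    qed
    finally show ?thesis by (simp add: sum_distrib_left)
  qed
  then show ?thesis
    by (intro bounded_linear_intro[of f "\<Sum>c\<in>C. norm (f' c) / inner c c * norm c"])
      (auto simp: linear_add[OF linear] linear_scale[OF linear])
qed

text \<open>Take for \<open>f u\<close> the projection of \<open>v\<close> onto the range: the
  residual is orthogonal to the range, so \<open>f'\<close> kills it.\<close>

lemma normal_equation: "\<exists>u. f' (v - f u) = 0"
proof -
  obtain C where C: "finite C" "span C = range f" "pairwise orthogonal C"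
    by (rule range_orthogonal_basis)
  obtain u where u: "f u = orth_proj C v"
    using orth_proj_in_span[of C v] C(2) by (metis imageE)
  have "inner x (f' (v - f u)) = 0" for x
    using orth_proj_orthogonal[OF C(1,3), of "f x" v] C(2) u adjoint
    by (metis inner_commute rangeI)
  then show ?thesis by (metis inner_eq_zero_iff)
qed

text \<open>Fredholm alternative: the residual of the normal equation lies in the kernel of
  \<open>f'\<close>, so it is orthogonal to \<open>v\<close> and to \<open>f u\<close>, hence to
  itself.\<close>

lemma in_range_if_orthogonal_kernel:
  assumes "\<And>k. f' k = 0 \<Longrightarrow> inner v k = 0"
  shows "v \<in> range f"
proof -
  obtain u where u: "f' (v - f u) = 0"
    using normal_equation by blast
  then have "inner v (v - f u) = 0" "inner (f u) (v - f u) = 0"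
    using assms adjoint by auto
  then have "inner (v - f u) (v - f u) = 0"
    by (simp add: inner_diff_left)
  then show ?thesis by simp
qed

text \<open>Fixed preimages of an orthogonal spanning set give each \<open>y\<close> in the range a
  preimage \<open>x\<close> with \<open>norm x \<le> B * norm y\<close>; the bound then follows from
  \<open>inner y y = inner x (f' y)\<close>.\<close>

lemma adjoint_coercive_on_range: "\<exists>c>0. \<forall>u. norm (f u) \<le> c * norm (f' (f u))"
proof -
  obtain C where C: "finite C" "span C = range f" "pairwise orthogonal C"
    by (rule range_orthogonal_basis)
  have "\<forall>c\<in>C. \<exists>u. c = f u"
    using C(2) span_superset[of C] by blast
  then obtain g where g: "\<And>c. c \<in> C \<Longrightarrow> f (g c) = c"
    by metis
  define B where "B = (\<Sum>c\<in>C. norm c / inner c c * norm (g c))"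
  have B0: "0 \<le> B"
    unfolding B_def by (intro sum_nonneg mult_nonneg_nonneg divide_nonneg_nonneg) auto
  \<comment> \<open>\<open>B\<close> is 0 when the range is trivial, so \<open>B + 1\<close> serves
    as the positive constant.\<close>
  have main: "norm y \<le> (B + 1) * norm (f' y)" if y: "y \<in> range f" for y
  proof -
    define x where "x = (\<Sum>c\<in>C. (inner y c / inner c c) *\<^sub>R g c)"
    have "f x = orth_proj C y"
      unfolding x_def orth_proj_def linear_sum[OF linear] linear_scale[OF linear]
      by (intro sum.cong) (auto simp: g)
    then have fx: "f x = y"
      using orth_proj_id[OF C(1,3)] C(2) y by simp
    have "norm x \<le> (\<Sum>c\<in>C. norm y * (norm c / inner c c * norm (g c)))"
      unfolding x_def
    proof (rule sum_norm_le)
      fix c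
      have "norm ((inner y c / inner c c) *\<^sub>R g c) = \<bar>inner y c\<bar> / inner c c * norm (g c)"
        by simp
      also have "\<dots> \<le> (norm y * norm c) / inner c c * norm (g c)"
        by (intro mult_right_mono divide_right_mono Cauchy_Schwarz_ineq2) auto
      finally show "norm ((inner y c / inner c c) *\<^sub>R g c)
          \<le> norm y * (norm c / inner c c * norm (g c))" by simp
    qed
    then have nx: "norm x \<le> norm y * B"
      by (simp add: B_def sum_distrib_left)
    have "norm y * norm y = inner (f x) y"
      by (simp add: fx norm_eq_sqrt_inner)
    also have "\<dots> = inner x (f' y)"
      by (rule adjoint)
    also have "\<dots> \<le> norm x * norm (f' y)"
      by (rule norm_cauchy_schwarz)
    also have "\<dots> \<le> (norm y * B) * norm (f' y)"
      by (intro mult_right_mono nx) auto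
    finally have "norm y * norm y \<le> norm y * (B * norm (f' y))"
      by simp
    then have "norm y \<le> B * norm (f' y)"
      using B0 mult_le_cancel_left_pos[of "norm y" "norm y" "B * norm (f' y)"]
      by (cases "y = 0") simp_all
    then show ?thesis
      by (simp add: distrib_right) (meson add_increasing2 norm_ge_zero)
  qed
  then show ?thesis
    using B0 by (intro exI[of _ "B + 1"]) auto
qed

end

text \<open>This is the operator inequality \<open>H^2 \<le> c H\<close>, with \<open>c\<close> a
  bound on the norm of \<open>H\<close>: evaluate the form one gradient step away from
  \<open>x\<close>.\<close>

lemma psd_norm_square_le:
  fixes H :: "'a::real_inner \<Rightarrow> 'a"
  assumes H: "bounded_linear H"
    and sym: "\<And>x y. inner (H x) y = inner x (H y)"
    and psd: "\<And>x. 0 \<le> inner (H x) x"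
  shows "\<exists>c>0. \<forall>x. (norm (H x))\<^sup>2 \<le> c * inner (H x) x"
proof -
  interpret H: bounded_linear H by fact
  obtain c where c: "0 < c" "\<And>x. norm (H x) \<le> norm x * c"
    using H.pos_bounded by blast
  have "(norm (H x))\<^sup>2 \<le> c * inner (H x) x" for x
  proof -
    define y where "y = H x"
    have "inner (H y) y \<le> norm (H y) * norm y"
      by (rule norm_cauchy_schwarz)
    also have "\<dots> \<le> (norm y * c) * norm y"
      by (intro mult_right_mono c) auto
    finally have Hy: "inner (H y) y \<le> c * (norm y)\<^sup>2"
      by (simp add: power2_eq_square mult_ac)
    \<comment> \<open>The step length \<open>1 / c\<close> minimizes the upper bound
      \<open>inner y x - 2 s |y|^2 + s^2 c |y|^2\<close> over \<open>s\<close>.\<close>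
    have "0 \<le> inner (H (x - (1 / c) *\<^sub>R y)) (x - (1 / c) *\<^sub>R y)"
      by (rule psd)
    also have "\<dots> = inner y x - 2 / c * (norm y)\<^sup>2 + (1 / c)\<^sup>2 * inner (H y) y"
      using sym[of y x]
      by (simp add: H.diff H.scaleR inner_diff_left inner_diff_right y_def[symmetric]
          dot_square_norm power2_eq_square algebra_simps inner_commute)
    also have "\<dots> \<le> inner y x - 2 / c * (norm y)\<^sup>2 + (1 / c)\<^sup>2 * (c * (norm y)\<^sup>2)"
      by (intro add_left_mono mult_left_mono Hy) auto
    also have "\<dots> = inner y x - (norm y)\<^sup>2 / c"
      using c(1) by (simp add: power2_eq_square field_simps)
    finally show ?thesis
      using c(1) by (simp add: y_def field_simps)
  qed
  with c(1) show ?thesis by blast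
qed

section \<open>Saddle-point flows\<close>

text \<open>Gronwall's inequality with the integrating factor \<open>exp (\<mu> * t)\<close>. Rate 0
  gives monotonicity, a positive rate gives decay.\<close>

lemma exponential_bound_of_deriv_le:
  fixes V :: "real \<Rightarrow> real"
  assumes V: "\<And>t. 0 \<le> t \<Longrightarrow> (V has_real_derivative V' t) (at t within {0..})"
    and le: "\<And>t. 0 \<le> t \<Longrightarrow> V' t \<le> - \<mu> * V t"
    and t: "0 \<le> t"
  shows "V t \<le> V 0 * exp (- \<mu> * t)"
proof -
  define g where "g = (\<lambda>t. V t * exp (\<mu> * t))"
  have dg: "(g has_real_derivative (V' t + \<mu> * V t) * exp (\<mu> * t)) (at t within {0..})"
    if "0 \<le> t" for t
    unfolding g_def using that
    by (auto intro!: derivative_eq_intros V simp: algebra_simps)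
  have "g t \<le> g 0"
  proof (rule DERIV_nonpos_imp_decreasing_open[OF t])
    fix s assume s: "0 < s" "s < t"
    \<comment> \<open>At interior points the one-sided derivative is two-sided; the end points are
      covered by continuity.\<close>
    have "at s within {0..} = at s"
      using s(1) by (intro at_within_interior) auto
    moreover have "(V' s + \<mu> * V s) * exp (\<mu> * s) \<le> 0"
      using le[of s] s(1) by (intro mult_nonpos_nonneg) auto
    ultimately show "\<exists>y. DERIV g s :> y \<and> y \<le> 0"
      using dg[of s] s(1) by auto
  next
    have "continuous_on {0..} g"
      unfolding continuous_on_eq_continuous_within
      using dg by (auto intro: DERIV_continuous)
    then show "continuous_on {0..t} g"
      by (rule continuous_on_subset) auto
  qed
  then have "V t * exp (\<mu> * t) * exp (- \<mu> * t) \<le> V 0 * exp (- \<mu> * t)"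
    by (intro mult_right_mono) (auto simp: g_def)
  then show ?thesis
    by (simp add: mult.assoc exp_add[symmetric])
qed

lemma has_real_derivative_inner:
  assumes "(f has_vector_derivative f') (at t within A)" "(g has_vector_derivative g') (at t within A)"
  shows "((\<lambda>t. inner (f t) (g t)) has_real_derivative inner (f t) g' + inner f' (g t)) (at t within A)"
  unfolding has_real_derivative_iff_has_vector_derivative
  using bounded_bilinear.has_vector_derivative[OF bounded_bilinear_inner assms] .

lemma norm_square_diff_le:
  fixes x y :: "'c::real_normed_vector"
  shows "(norm (x - y))\<^sup>2 \<le> 2 * (norm x)\<^sup>2 + 2 * (norm y)\<^sup>2"
proof -
  have "(norm (x - y))\<^sup>2 \<le> (norm x + norm y)\<^sup>2"
    by (intro power_mono norm_triangle_ineq4) auto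
  also have "\<dots> \<le> 2 * (norm x)\<^sup>2 + 2 * (norm y)\<^sup>2"
    using sum_squares_bound[of "norm x" "norm y"] by (simp add: power2_sum)
  finally show ?thesis .
qed

text \<open>The flow \<open>w' = b - H w - K\<^sup>T l\<close>, \<open>l' = K w\<close>.  The bound \<open>ex_norm_K_le\<close> is what the augmentation
  terms of an augmented Lagrangian provide; it makes \<open>ker H\<close> a subspace of \<open>ker K\<close> and so excludes
  oscillations.\<close>

locale saddle_flow =
  fixes H :: "'w::real_inner \<Rightarrow> 'w" and K :: "'w \<Rightarrow> 'l::real_inner" and Kt :: "'l \<Rightarrow> 'w"
    and b :: 'w
  assumes H_sym: "inner (H x) y = inner x (H y)"
    and H_psd: "0 \<le> inner (H x) x"
    and K_adjoint: "inner (K x) l = inner x (Kt l)"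
    and finite_rank_H: "finite_rank H"
    and finite_rank_K: "finite_rank K"
    and finite_rank_Kt: "finite_rank Kt"
    and ex_norm_K_le: "\<exists>\<gamma>. \<forall>x. (norm (K x))\<^sup>2 \<le> \<gamma> * inner (H x) x"
    and b_orthogonal: "H x = 0 \<Longrightarrow> inner b x = 0"
begin

sublocale H: finite_rank_adjoint H H
  by unfold_locales (auto simp: H_sym finite_rank_H)

sublocale K: finite_rank_adjoint K Kt
  by unfold_locales (auto simp: K_adjoint finite_rank_K)

sublocale Kt: finite_rank_adjoint Kt K
  by unfold_locales (metis K_adjoint inner_commute, rule finite_rank_Kt)

section \<open>The linear part of the flow, its kernel, and existence of equilibria\<close>

definition M :: "'w \<times> 'l \<Rightarrow> 'w \<times> 'l" where
  "M z = (- H (fst z) - Kt (snd z), K (fst z))"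

definition Mt :: "'w \<times> 'l \<Rightarrow> 'w \<times> 'l" where
  "Mt z = (Kt (snd z) - H (fst z), - K (fst z))"

sublocale M: finite_rank_adjoint M Mt
proof
  show "inner (M x) y = inner x (Mt y)" for x y
  proof -
    have "inner (Kt (snd x)) (fst y) = inner (snd x) (K (fst y))"
      by (rule Kt.adjoint)
    then show ?thesis
      by (simp add: M_def Mt_def inner_prod_def inner_diff_left inner_diff_right H_sym K_adjoint)
  qed
  show "finite_rank M"
    unfolding M_def
    by (intro finite_rank_Pair finite_rank_diff finite_rank_uminus)
      (rule finite_rank_compose[OF finite_rank_H] finite_rank_compose[OF finite_rank_K]
        finite_rank_compose[OF finite_rank_Kt])+
qed

lemma K_eq_0_if_H_eq_0: "H x = 0 \<Longrightarrow> K x = 0"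
  using ex_norm_K_le by (metis inner_zero_left mult_zero_right norm_eq_zero power2_less_eq_zero_iff)

lemma norm_H_le: "\<exists>c>0. \<forall>x. (norm (H x))\<^sup>2 \<le> c * inner (H x) x"
  by (rule psd_norm_square_le[OF H.bounded_linear H_sym H_psd])

text \<open>The bound \<open>norm_H_le\<close> turns a vanishing form into a vanishing
  vector.\<close>

lemma H_eq_0_iff: "H x = 0 \<longleftrightarrow> inner (H x) x = 0"
proof
  assume "inner (H x) x = 0"
  moreover obtain c where "(norm (H x))\<^sup>2 \<le> c * inner (H x) x"
    using norm_H_le by blast
  ultimately show "H x = 0" by simp
qed simp

text \<open>The part of \<open>M\<close> made of \<open>K\<close> and \<open>Kt\<close> is skew, so
  pairing a kernel vector with itself leaves only \<open>inner (H w) w = 0\<close>, which forces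
  \<open>H w = 0\<close>.\<close>

lemma M_kernel: "M z = 0 \<longleftrightarrow> H (fst z) = 0 \<and> Kt (snd z) = 0"
proof
  assume "M z = 0"
  then have *: "K (fst z) = 0" "H (fst z) = - Kt (snd z)"
    by (auto simp: M_def zero_prod_def) (metis minus_minus)
  have "inner (H (fst z)) (fst z) = - inner (snd z) (K (fst z))"
    by (simp add: *(2) Kt.adjoint del: *(1))
  then show "H (fst z) = 0 \<and> Kt (snd z) = 0"
    using * H_eq_0_iff[of "fst z"] by auto
qed (auto simp: M_def zero_prod_def K_eq_0_if_H_eq_0)

text \<open>Transposition only reverses the sign of the skew part, so the same pairing
  applies.\<close>

lemma Mt_kernel: "Mt z = 0 \<longleftrightarrow> M z = 0"
proof
  assume "Mt z = 0"
  then have *: "K (fst z) = 0" "H (fst z) = Kt (snd z)"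
    by (auto simp: Mt_def zero_prod_def)
  have "inner (H (fst z)) (fst z) = inner (snd z) (K (fst z))"
    by (simp add: *(2) Kt.adjoint)
  then show "M z = 0"
    using * H_eq_0_iff[of "fst z"] by (simp add: M_kernel)
qed (use M_kernel K_eq_0_if_H_eq_0 in \<open>auto simp: Mt_def zero_prod_def\<close>)

definition equilibrium :: "'w \<times> 'l \<Rightarrow> bool" where
  "equilibrium z \<longleftrightarrow> M z + (b, 0) = 0"

definition solution :: "(real \<Rightarrow> 'w \<times> 'l) \<Rightarrow> bool" where
  "solution z \<longleftrightarrow> (\<forall>t\<ge>0. (z has_vector_derivative M (z t) + (b, 0)) (at t within {0..}))"

text \<open>By the Fredholm alternative it suffices that \<open>(b, 0)\<close> is orthogonal to the
  kernel of \<open>Mt\<close>; there \<open>H\<close> annihilates the first component, so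
  \<open>b_orthogonal\<close> applies.\<close>

lemma ex_equilibrium: "\<exists>z. equilibrium z"
proof -
  have "(b, 0) \<in> range M"
    by (rule M.in_range_if_orthogonal_kernel)
      (auto simp: Mt_kernel M_kernel inner_prod_def b_orthogonal)
  then obtain u where "M u = (b, 0)"
    by (metis imageE)
  then have "equilibrium (- u)"
    by (simp add: equilibrium_def linear_neg[OF M.linear] zero_prod_def)
  then show ?thesis ..
qed

section \<open>Deviations from equilibria along solutions\<close>

lemma deviation_derivative:
  assumes "solution z" "equilibrium e" "0 \<le> t"
  shows "((\<lambda>t. z t - e) has_vector_derivative M (z t - e)) (at t within {0..})"
proof -
  have "M (z t) + (b, 0) = M (z t - e)"
    using assms(2) by (simp add: equilibrium_def linear_diff[OF M.linear] eq_neg_iff_add_eq_0[symmetric])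
  then show ?thesis
    using assms(1,3) by (auto simp: solution_def has_vector_derivative_diff_const)
qed

text \<open>Energy identity: the terms with \<open>K\<close> and \<open>Kt\<close> cancel, and only
  the dissipation by \<open>H\<close> remains.\<close>

lemma inner_M: "inner z (M z) = - inner (H (fst z)) (fst z)"
proof -
  have "inner (fst z) (Kt (snd z)) = inner (snd z) (K (fst z))"
    by (metis K_adjoint inner_commute)
  then show ?thesis
    by (simp add: M_def inner_prod_def inner_diff_right inner_commute)
qed

lemma dist_equilibrium_decreasing:
  assumes "solution z" "equilibrium e" "0 \<le> t"
  shows "norm (z t - e) \<le> norm (z 0 - e)"
proof -
  let ?V = "\<lambda>t. inner (z t - e) (z t - e)"
  \<comment> \<open>Gronwall with rate 0, that is, monotonicity; the derivative of \<open>?V\<close>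
    is twice the energy identity.\<close>
  have "?V t \<le> ?V 0 * exp (- 0 * t)"
  proof (rule exponential_bound_of_deriv_le[OF _ _ assms(3)])
    show "(?V has_real_derivative
        inner (z t - e) (M (z t - e)) + inner (M (z t - e)) (z t - e)) (at t within {0..})"
      if "0 \<le> t" for t
      using deviation_derivative[OF assms(1,2) that] by (intro has_real_derivative_inner)
    show "inner (z t - e) (M (z t - e)) + inner (M (z t - e)) (z t - e) \<le> - 0 * ?V t" for t
      using inner_M[of "z t - e"] H_psd[of "fst (z t - e)"] by (simp add: inner_commute)
  qed
  then show ?thesis
    by (simp add: norm_eq_sqrt_inner)
qed

text \<open>The component of \<open>z - e\<close> along \<open>ker M\<^sup>T = ker M\<close> is constant in time; moving the equilibrium by it
  puts the deviation into \<open>range M\<close> for good.\<close>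

lemma ex_equilibrium_deviation_in_range:
  assumes "solution z"
  shows "\<exists>e. equilibrium e \<and> (\<forall>t\<ge>0. z t - e \<in> range M)"
proof -
  obtain e0 where e0: "equilibrium e0"
    using ex_equilibrium by blast
  \<comment> \<open>\<open>M u\<close> is the projection of \<open>z 0 - e0\<close> onto the range
    of \<open>M\<close>. The rest is killed by \<open>Mt\<close>, hence by \<open>M\<close>, so
    adding it to \<open>e0\<close> gives another equilibrium.\<close>
  obtain u where u: "Mt (z 0 - e0 - M u) = 0"
    using M.normal_equation by blast
  define e where "e = z 0 - M u"
  have "M (e - e0) = 0"
    using u by (simp add: Mt_kernel e_def algebra_simps)
  then have e: "equilibrium e"
    using e0 by (simp add: equilibrium_def linear_diff[OF M.linear])
  have "z t - e \<in> range M" if t: "0 \<le> t" for t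
  proof (rule M.in_range_if_orthogonal_kernel)
    fix k assume k: "Mt k = 0"
    \<comment> \<open>Moving \<open>M\<close> across the inner product turns the derivative into
      \<open>inner (z s - e) (Mt k) = 0\<close>.\<close>
    have d: "((\<lambda>t. inner (z t - e) k) has_real_derivative 0) (at s within {0..})" if "s \<in> {0..}" for s
    proof -
      have "((\<lambda>t. inner (z t - e) k) has_real_derivative
          inner (z s - e) 0 + inner (M (z s - e)) k) (at s within {0..})"
        using that deviation_derivative[OF assms e] by (intro has_real_derivative_inner) auto
      then show ?thesis by (simp add: M.adjoint k)
    qed
    then obtain c where "\<And>s. s \<in> {0..} \<Longrightarrow> inner (z s - e) k = c"
      using has_field_derivative_zero_constant[OF convex_real_interval(1) d] by blast
    then have "inner (z t - e) k = inner (z 0 - e) k"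
      using t by auto
    then show "inner (z t - e) k = 0"
      by (simp add: e_def M.adjoint k)
  qed
  with e show ?thesis by blast
qed

text \<open>The Lyapunov function is \<open>V = |z|\<^sup>2 / 2 + \<epsilon> (w \<bullet> K\<^sup>T l)\<close>: the norm alone only dissipates in the
  directions seen by \<open>H\<close>, the cross term adds \<open>- \<epsilon> |K\<^sup>T l|\<^sup>2\<close> to the derivative.\<close>

definition lyap :: "real \<Rightarrow> 'w \<times> 'l \<Rightarrow> real" where
  "lyap \<epsilon> z = inner z z / 2 + \<epsilon> * inner (fst z) (Kt (snd z))"

definition lyap_deriv :: "real \<Rightarrow> 'w \<times> 'l \<Rightarrow> real" where
  "lyap_deriv \<epsilon> z = inner z (M z) +
     \<epsilon> * (inner (fst z) (Kt (K (fst z))) + inner (- H (fst z) - Kt (snd z)) (Kt (snd z)))"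

lemma lyap_has_derivative:
  assumes "(z has_vector_derivative M (z t)) (at t within {0..})"
  shows "((\<lambda>t. lyap \<epsilon> (z t)) has_real_derivative lyap_deriv \<epsilon> (z t)) (at t within {0..})"
proof -
  have f: "((\<lambda>t. fst (z t)) has_vector_derivative - H (fst (z t)) - Kt (snd (z t))) (at t within {0..})"
    using bounded_linear.has_vector_derivative[OF bounded_linear_fst assms] by (simp add: M_def)
  have "((\<lambda>t. snd (z t)) has_vector_derivative K (fst (z t))) (at t within {0..})"
    using bounded_linear.has_vector_derivative[OF bounded_linear_snd assms] by (simp add: M_def)
  then have s: "((\<lambda>t. Kt (snd (z t))) has_vector_derivative Kt (K (fst (z t)))) (at t within {0..})"
    by (rule bounded_linear.has_vector_derivative[OF Kt.bounded_linear])
  show ?thesis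
    unfolding lyap_def lyap_deriv_def
    by (rule derivative_eq_intros has_real_derivative_inner[OF assms assms]
        has_real_derivative_inner[OF f s] refl | simp add: inner_commute)+
qed

text \<open>On \<open>range M\<close> the norm of \<open>z\<close> is controlled by that of
  \<open>Mt z\<close>, and the latter by \<open>d = inner (H w) w\<close> and \<open>|k|^2\<close>
  with \<open>k = Kt l\<close>, the two quantities that the derivative dissipates.\<close>

lemma lyap_estimates:
  "\<exists>\<epsilon> \<mu>. 0 < \<mu> \<and> (\<forall>z. (norm z)\<^sup>2 / 4 \<le> lyap \<epsilon> z) \<and>
     (\<forall>z \<in> range M. lyap_deriv \<epsilon> z \<le> - \<mu> * lyap \<epsilon> z)"
proof -
  obtain c where c: "0 < c" "\<And>u. norm (M u) \<le> c * norm (Mt (M u))"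
    using M.adjoint_coercive_on_range by blast
  obtain h where h: "0 < h" "\<And>x. (norm (H x))\<^sup>2 \<le> h * inner (H x) x"
    using norm_H_le by blast
  obtain \<beta> where \<beta>: "0 < \<beta>" "\<And>x. norm (K x) \<le> norm x * \<beta>"
    using bounded_linear.pos_bounded[OF K.bounded_linear] by blast
  obtain \<gamma> where norm_K_le: "\<And>x. (norm (K x))\<^sup>2 \<le> \<gamma> * inner (H x) x"
    using ex_norm_K_le by blast
  \<comment> \<open>One constant that bounds both \<open>|H w|^2\<close> and \<open>|K w|^2\<close>
    by a multiple of \<open>inner (H w) w\<close>.\<close>
  define g where "g = max h \<gamma>"
  have g: "0 < g" "(norm (H x))\<^sup>2 \<le> g * inner (H x) x" "(norm (K x))\<^sup>2 \<le> g * inner (H x) x" for x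
    using h(1) order_trans[OF h(2)[of x] mult_right_mono[OF max.cobounded1 H_psd[of x]]]
      order_trans[OF norm_K_le[of x] mult_right_mono[OF max.cobounded2 H_psd[of x]]]
    by (auto simp: g_def)
  \<comment> \<open>The first bound keeps the cross term within a quarter of \<open>|z|^2\<close>;
    the second lets half of the dissipation \<open>d\<close> absorb the term
    \<open>3 / 2 * \<epsilon> * g * d\<close> of the wrong sign.\<close>
  define \<epsilon> where "\<epsilon> = min (1 / (2 * \<beta>)) (1 / (3 * g))"
  have \<epsilon>: "0 < \<epsilon>" "\<epsilon> * \<beta> \<le> 1 / 2" "\<epsilon> * g \<le> 1 / 3"
    using \<beta>(1) g(1) by (auto simp: \<epsilon>_def min_def field_simps)
  \<comment> \<open>Chosen so that the rate \<open>\<epsilon> / (4 * c\<^sup>2)\<close> obtained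
    below equals \<open>3 / 4 * \<mu>\<close>, with the 3/4 from \<open>upper\<close>.\<close>
  define \<mu> where "\<mu> = \<epsilon> / (3 * c\<^sup>2)"
  have cross: "\<bar>\<epsilon> * inner (fst z) (Kt (snd z))\<bar> \<le> (norm z)\<^sup>2 / 4" for z
  proof -
    have "\<bar>inner (fst z) (Kt (snd z))\<bar> = \<bar>inner (K (fst z)) (snd z)\<bar>"
      by (simp add: K_adjoint)
    also have "\<dots> \<le> norm (K (fst z)) * norm (snd z)"
      by (rule Cauchy_Schwarz_ineq2)
    also have "\<dots> \<le> (norm (fst z) * \<beta>) * norm (snd z)"
      by (intro mult_right_mono \<beta>) auto
    finally have "\<bar>inner (fst z) (Kt (snd z))\<bar> \<le> \<beta> * (norm (fst z) * norm (snd z))"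
      by (simp add: mult_ac)
    also have "\<dots> \<le> \<beta> * ((norm z)\<^sup>2 / 2)"
      using \<beta>(1) sum_squares_bound[of "norm (fst z)" "norm (snd z)"]
      by (intro mult_left_mono) (auto simp: norm_prod_def)
    finally have "\<epsilon> * \<bar>inner (fst z) (Kt (snd z))\<bar> \<le> (\<epsilon> * \<beta>) * ((norm z)\<^sup>2 / 2)"
      using \<epsilon>(1) by (simp add: mult.assoc)
    also have "\<dots> \<le> (1 / 2) * ((norm z)\<^sup>2 / 2)"
      by (intro mult_right_mono \<epsilon>) auto
    finally show ?thesis
      using \<epsilon>(1) by (simp add: abs_mult)
  qed
  have lower: "(norm z)\<^sup>2 / 4 \<le> lyap \<epsilon> z" and upper: "lyap \<epsilon> z \<le> 3 / 4 * (norm z)\<^sup>2" for z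
    using cross[of z] by (auto simp: lyap_def dot_square_norm abs_le_iff)
  have "lyap_deriv \<epsilon> z \<le> - \<mu> * lyap \<epsilon> z" if z: "z \<in> range M" for z
  proof -
    define w k where "w = fst z" and "k = Kt (snd z)"
    define d where "d = inner (H w) w"
    \<comment> \<open>Young's inequality for the mixed term; it uses up half of the dissipation in
      \<open>|k|^2\<close>.\<close>
    have "- inner (H w) k \<le> norm (H w) * norm k"
      using Cauchy_Schwarz_ineq2[of "H w" k] by simp
    also have "\<dots> \<le> ((norm (H w))\<^sup>2 + (norm k)\<^sup>2) / 2"
      using sum_squares_bound[of "norm (H w)" "norm k"] by simp
    also have "\<dots> \<le> (g * d + (norm k)\<^sup>2) / 2"
      using g(2)[of w] by (simp add: d_def)
    finally have "- inner (H w) k \<le> (g * d + (norm k)\<^sup>2) / 2" .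
    then have "inner w (Kt (K w)) + inner (- H w - k) k \<le> 3 / 2 * (g * d) - (norm k)\<^sup>2 / 2"
      using g(3)[of w] K_adjoint[of w "K w"]
      by (simp add: inner_diff_left dot_square_norm d_def field_simps)
    then have "\<epsilon> * (inner w (Kt (K w)) + inner (- H w - k) k)
        \<le> \<epsilon> * (3 / 2 * (g * d) - (norm k)\<^sup>2 / 2)"
      using \<epsilon>(1) by (intro mult_left_mono) auto
    moreover have "\<epsilon> * g * d \<le> 1 / 3 * d"
      using H_psd[of w] by (intro mult_right_mono \<epsilon>) (auto simp: d_def)
    ultimately have le1: "lyap_deriv \<epsilon> z \<le> - d / 2 - \<epsilon> / 2 * (norm k)\<^sup>2"
      unfolding lyap_deriv_def inner_M w_def[symmetric] k_def[symmetric] d_def[symmetric]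
      by (simp add: algebra_simps)
    have "(norm z)\<^sup>2 \<le> (c * norm (Mt z))\<^sup>2"
      using z c(2) by (intro power_mono) auto
    also have "\<dots> = c\<^sup>2 * ((norm (k - H w))\<^sup>2 + (norm (K w))\<^sup>2)"
      by (simp add: Mt_def norm_prod_def w_def k_def power_mult_distrib)
    also have "\<dots> \<le> c\<^sup>2 * (2 * (norm k)\<^sup>2 + 3 * (g * d))"
      using norm_square_diff_le[of k "H w"] g(2,3)[of w]
      by (intro mult_left_mono) (auto simp: d_def)
    \<comment> \<open>This factor makes the coefficient of \<open>|k|^2\<close> exactly the
      available \<open>\<epsilon> / 2\<close>; the remaining part is at most
      \<open>d / 4\<close>.\<close>
    finally have "(\<epsilon> / (4 * c\<^sup>2)) * (norm z)\<^sup>2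
        \<le> (\<epsilon> / (4 * c\<^sup>2)) * (c\<^sup>2 * (2 * (norm k)\<^sup>2 + 3 * (g * d)))"
      using \<epsilon>(1) by (intro mult_left_mono) auto
    also have "\<dots> = \<epsilon> / 2 * (norm k)\<^sup>2 + 3 / 4 * (\<epsilon> * g * d)"
      using c(1) by (simp add: field_simps)
    also have "\<dots> \<le> \<epsilon> / 2 * (norm k)\<^sup>2 + d / 2"
      using \<open>\<epsilon> * g * d \<le> 1 / 3 * d\<close> H_psd[of w] by (simp add: d_def)
    finally have "lyap_deriv \<epsilon> z \<le> - (\<epsilon> / (4 * c\<^sup>2) * (norm z)\<^sup>2)"
      using le1 by linarith
    also have "\<dots> = - \<mu> * (3 / 4 * (norm z)\<^sup>2)"
      by (simp add: \<mu>_def)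
    also have "\<dots> \<le> - \<mu> * lyap \<epsilon> z"
      using upper[of z] \<epsilon>(1) c(1) by (intro mult_left_mono_neg) (auto simp: \<mu>_def)
    finally show ?thesis .
  qed
  moreover have "0 < \<mu>"
    using \<epsilon>(1) c(1) by (simp add: \<mu>_def)
  ultimately show ?thesis
    using lower by blast
qed

text \<open>The deviation stays in \<open>range M\<close>, so the Lyapunov estimates apply at all
  times. Membership at time 0 is kept in the conclusion so that \<open>e\<close> can later be
  recognized as the image of a network state.\<close>

theorem exponential_convergence:
  assumes "solution z"
  shows "\<exists>e. equilibrium e \<and> z 0 - e \<in> range M \<and>
    (\<exists>c\<ge>0. \<exists>\<mu>>0. \<forall>t\<ge>0. norm (z t - e) \<le> c * exp (- \<mu> * t))"
proof -
  obtain e where e: "equilibrium e" and range: "\<And>t. 0 \<le> t \<Longrightarrow> z t - e \<in> range M"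
    using ex_equilibrium_deviation_in_range[OF assms] by blast
  obtain \<epsilon> \<mu> where \<mu>: "0 < \<mu>" and lower: "\<And>z. (norm z)\<^sup>2 / 4 \<le> lyap \<epsilon> z"
    and deriv: "\<And>z. z \<in> range M \<Longrightarrow> lyap_deriv \<epsilon> z \<le> - \<mu> * lyap \<epsilon> z"
    using lyap_estimates by blast
  define V where "V = lyap \<epsilon> (z 0 - e)"
  \<comment> \<open>Taking square roots in \<open>|z|^2 / 4 \<le> V exp (- \<mu> t)\<close> gives
    the factor 2 and halves the rate.\<close>
  have "norm (z t - e) \<le> (2 * sqrt V) * exp (- (\<mu> / 2) * t)" if t: "0 \<le> t" for t
  proof -
    have "lyap \<epsilon> (z t - e) \<le> V * exp (- \<mu> * t)"
      unfolding V_def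
      by (rule exponential_bound_of_deriv_le[OF lyap_has_derivative deriv t])
        (use deviation_derivative[OF assms e] range in auto)
    then have "(norm (z t - e))\<^sup>2 \<le> 4 * (V * exp (- \<mu> * t))"
      using lower[of "z t - e"] by simp
    then have "norm (z t - e) \<le> sqrt (4 * (V * exp (- \<mu> * t)))"
      by (rule real_le_rsqrt)
    also have "exp (- \<mu> * t) = (exp (- (\<mu> / 2) * t))\<^sup>2"
      by (simp add: power2_eq_square exp_add[symmetric])
    finally show ?thesis
      by (simp add: real_sqrt_mult)
  qed
  moreover have "0 \<le> V"
    using lower[of "z 0 - e"] by (simp add: V_def order_trans[OF _ lower])
  ultimately show ?thesis
    using e \<mu> range[of 0] by (intro exI[of _ e] conjI exI[of _ "2 * sqrt V"] exI[of _ "\<mu> / 2"]) auto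
qed

end

section \<open>Consensus-constrained least squares\<close>

text \<open>The saddle-point flow of the augmented Lagrangian of: minimize \<open>|C y - f|\<^sup>2 / 2\<close> subject to
  \<open>R x = S y\<close>, \<open>L\<^sub>x x = 0\<close>, \<open>L\<^sub>y y = 0\<close>.\<close>

locale consensus_flow =
  R: finite_rank_adjoint R R' + R': finite_rank_adjoint R' R +
  S: finite_rank_adjoint S S' + S': finite_rank_adjoint S' S +
  C: finite_rank_adjoint C C' + C': finite_rank_adjoint C' C +
  Lx: finite_rank_adjoint Lx Lx + Ly: finite_rank_adjoint Ly Ly
  for R :: "'x::real_inner \<Rightarrow> 'g::real_inner" and R' and S :: "'y::real_inner \<Rightarrow> 'g" and S'
    and C :: "'y \<Rightarrow> 'c::real_inner" and C' and Lx :: "'x \<Rightarrow> 'x" and Ly :: "'y \<Rightarrow> 'y" +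
  fixes f :: 'c
  assumes Lx_psd: "0 \<le> inner (Lx x) x" and Ly_psd: "0 \<le> inner (Ly y) y"
begin

definition G :: "'x \<times> 'y \<Rightarrow> 'g" where
  "G w = R (fst w) - S (snd w)"

definition H :: "'x \<times> 'y \<Rightarrow> 'x \<times> 'y" where
  "H w = (R' (G w) + Lx (fst w), C' (C (snd w)) - S' (G w) + Ly (snd w))"

definition K :: "'x \<times> 'y \<Rightarrow> 'x \<times> 'y \<times> 'g" where
  "K w = (Lx (fst w), Ly (snd w), G w)"

definition Kt :: "'x \<times> 'y \<times> 'g \<Rightarrow> 'x \<times> 'y" where
  "Kt l = (Lx (fst l) + R' (snd (snd l)), Ly (fst (snd l)) - S' (snd (snd l)))"

text \<open>\<open>H\<close> is the Hessian of the augmented Lagrangian; symmetry and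
  semidefiniteness can be read off from this form.\<close>

lemma inner_H:
  "inner (H w) v = inner (G w) (G v) + inner (C (snd w)) (C (snd v))
     + inner (Lx (fst w)) (fst v) + inner (Ly (snd w)) (snd v)"
  by (simp add: H_def inner_prod_def inner_add_left inner_diff_left R'.adjoint S'.adjoint C'.adjoint
      G_def[of v] inner_diff_right)

sublocale saddle_flow H K Kt "(0, C' f)"
proof
  show "inner (H x) y = inner x (H y)" for x y
    unfolding inner_commute[of x] inner_H
    using Lx.adjoint[of "fst x" "fst y"] Ly.adjoint[of "snd x" "snd y"] by (simp add: inner_commute)
  show psd: "0 \<le> inner (H x) x" for x
    unfolding inner_H by (simp add: Lx_psd Ly_psd)
  show "inner (K x) l = inner x (Kt l)" for x l
    by (simp add: K_def Kt_def G_def inner_prod_def inner_add_right inner_diff_left inner_diff_right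
        Lx.adjoint Ly.adjoint R.adjoint S.adjoint)
  have G: "finite_rank G"
    unfolding G_def
    by (rule finite_rank_diff)
      (rule finite_rank_compose[OF R.finite_rank] finite_rank_compose[OF S.finite_rank])+
  note compose = finite_rank_compose[OF R'.finite_rank] finite_rank_compose[OF S'.finite_rank]
    finite_rank_compose[OF C'.finite_rank] finite_rank_compose[OF Lx.finite_rank]
    finite_rank_compose[OF Ly.finite_rank]
  show "finite_rank H"
    unfolding H_def by (intro finite_rank_Pair finite_rank_add finite_rank_diff) (rule compose)+
  show "finite_rank K"
    unfolding K_def by (intro finite_rank_Pair) (rule compose G)+
  show "finite_rank Kt"
    unfolding Kt_def by (intro finite_rank_Pair finite_rank_add finite_rank_diff) (rule compose)+
  obtain cx where cx: "0 < cx" "\<And>x. (norm (Lx x))\<^sup>2 \<le> cx * inner (Lx x) x"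
    using psd_norm_square_le[OF Lx.bounded_linear Lx.adjoint Lx_psd] by blast
  obtain cy where cy: "0 < cy" "\<And>y. (norm (Ly y))\<^sup>2 \<le> cy * inner (Ly y) y"
    using psd_norm_square_le[OF Ly.bounded_linear Ly.adjoint Ly_psd] by blast
  \<comment> \<open>Each component of \<open>K w\<close> is bounded by its own summand of
    \<open>inner (H w) w\<close>; the summand of \<open>C\<close> is dropped.\<close>
  have "(norm (K w))\<^sup>2 \<le> (1 + cx + cy) * inner (H w) w" for w
  proof -
    define u v where "u = inner (Lx (fst w)) (fst w)" and "v = inner (Ly (snd w)) (snd w)"
    have uv: "0 \<le> u" "0 \<le> v"
      by (simp_all add: u_def v_def Lx_psd Ly_psd)
    have "(norm (K w))\<^sup>2 = (norm (Lx (fst w)))\<^sup>2 + (norm (Ly (snd w)))\<^sup>2 + (norm (G w))\<^sup>2"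
      by (simp add: K_def norm_prod_def)
    also have "\<dots> \<le> cx * u + cy * v + (norm (G w))\<^sup>2"
      unfolding u_def v_def by (intro add_mono cx cy order_refl)
    also have "\<dots> \<le> (1 + cx + cy) * (u + v + (norm (G w))\<^sup>2)"
    proof -
      have "0 \<le> u + v + cy * u + cx * v + (cx + cy) * (norm (G w))\<^sup>2"
        using cx(1) cy(1) uv by (intro add_nonneg_nonneg mult_nonneg_nonneg) auto
      then show ?thesis
        by (simp add: algebra_simps)
    qed
    also have "\<dots> \<le> (1 + cx + cy) * inner (H w) w"
      using cx(1) cy(1) by (intro mult_left_mono) (auto simp: inner_H u_def v_def dot_square_norm)
    finally show ?thesis .
  qed
  then show "\<exists>\<gamma>. \<forall>w. (norm (K w))\<^sup>2 \<le> \<gamma> * inner (H w) w"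
    by blast
  \<comment> \<open>The summands of the form are nonnegative, so that of \<open>C\<close> vanishes
    and \<open>C (snd x) = 0\<close>; the claim follows by moving \<open>C'\<close> across the inner
    product.\<close>
  show "inner (0, C' f) x = 0" if "H x = 0" for x
  proof -
    have "inner (H x) x = 0"
      using that by simp
    then have "inner (C (snd x)) (C (snd x)) = 0"
      unfolding inner_H using Lx_psd[of "fst x"] Ly_psd[of "snd x"]
      by (smt (verit) inner_ge_zero)
    then show ?thesis
      by (simp add: inner_prod_def C'.adjoint)
  qed
qed

lemma equilibrium_feasible:
  assumes "equilibrium z"
  shows "R (fst (fst z)) = S (snd (fst z))" "Lx (fst (fst z)) = 0" "Ly (snd (fst z)) = 0"
  using assms by (auto simp: equilibrium_def M_def K_def G_def zero_prod_def)

text \<open>Karush-Kuhn-Tucker argument: the multipliers make the gradient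
  \<open>C' (C y0 - f)\<close> orthogonal to every feasible direction, and Pythagoras then compares
  the residuals.\<close>

lemma equilibrium_optimal:
  assumes z: "equilibrium z"
    and feasible: "R x = S y" "Lx x = 0" "Ly y = 0"
  shows "(norm (C (snd (fst z)) - f))\<^sup>2 \<le> (norm (C y - f))\<^sup>2"
proof -
  obtain x0 y0 l1 l2 l3 where z_eq: "z = ((x0, y0), (l1, l2, l3))"
    by (metis prod.collapse)
  have feas0: "R x0 = S y0" "Lx x0 = 0" "Ly y0 = 0"
    using equilibrium_feasible[OF z] by (auto simp: z_eq)
  have "- (Lx l1 + R' l3) = 0" and grad: "- C' (C y0) - (Ly l2 - S' l3) + C' f = 0"
    using z feas0 by (auto simp: equilibrium_def z_eq M_def H_def Kt_def G_def zero_prod_def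
        linear_0[OF R'.linear] linear_0[OF S'.linear])
  then have R'l3: "R' l3 = - Lx l1"
    by (metis add_eq_0_iff neg_equal_0_iff_equal)
  have "C' (C y0 - f) - (S' l3 - Ly l2) = - (- C' (C y0) - (Ly l2 - S' l3) + C' f)"
    by (simp add: linear_diff[OF C'.linear])
  then have "C' (C y0 - f) = S' l3 - Ly l2"
    using grad by simp
  then have "inner (C (y - y0)) (C y0 - f) = inner (y - y0) (S' l3 - Ly l2)"
    by (simp add: C.adjoint)
  also have "\<dots> = inner (S (y - y0)) l3 - inner (Ly (y - y0)) l2"
    by (simp add: inner_diff_right S.adjoint Ly.adjoint)
  \<comment> \<open>The difference of two feasible points is feasible for the linear constraints,
    which trades \<open>S\<close> for \<open>R\<close> and removes \<open>Ly\<close>; stationarity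
    in \<open>x\<close> then trades \<open>l3\<close> for \<open>l1\<close>.\<close>
  also have "\<dots> = inner (R (x - x0)) l3"
    using feas0 feasible
    by (simp add: linear_diff[OF R.linear] linear_diff[OF S.linear] linear_diff[OF Ly.linear])
  also have "\<dots> = - inner (Lx (x - x0)) l1"
    by (simp add: R.adjoint R'l3 Lx.adjoint)
  also have "\<dots> = 0"
    using feas0 feasible by (simp add: linear_diff[OF Lx.linear])
  finally have orth: "inner (C (y - y0)) (C y0 - f) = 0" .
  have "C y - f = C (y - y0) + (C y0 - f)"
    by (simp add: linear_diff[OF C.linear])
  then have "(norm (C y - f))\<^sup>2 = (norm (C (y - y0)))\<^sup>2 + (norm (C y0 - f))\<^sup>2"
    using norm_add_Pythagorean[of "C (y - y0)" "C y0 - f"] orth by (simp only: orthogonal_def)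
  then show ?thesis
    by (simp add: z_eq)
qed

end

section \<open>Finitely supported families as an inner product space\<close>

instantiation poly_mapping :: (type, real_vector) real_vector
begin

lift_definition scaleR_poly_mapping :: "real \<Rightarrow> ('a \<Rightarrow>\<^sub>0 'b) \<Rightarrow> 'a \<Rightarrow>\<^sub>0 'b" is "\<lambda>c x k. c *\<^sub>R x k"
  by (rule finite_subset[rotated]) auto

instance
  by standard (transfer, auto simp: scaleR_add_right scaleR_add_left)+

end

abbreviation lookup :: "('a \<Rightarrow>\<^sub>0 'b::zero) \<Rightarrow> 'a \<Rightarrow> 'b" where
  "lookup \<equiv> Poly_Mapping.lookup"

abbreviation keys :: "('a \<Rightarrow>\<^sub>0 'b::zero) \<Rightarrow> 'a set" where
  "keys \<equiv> Poly_Mapping.keys"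

lemma lookup_scaleR [simp]: "lookup (c *\<^sub>R x) k = c *\<^sub>R lookup x k"
  by transfer simp

instantiation poly_mapping :: (type, real_inner) real_inner
begin

text \<open>Every summand outside \<open>keys x\<close> has a zero factor, so this is the usual
  inner product over all indices.\<close>

definition inner_poly_mapping :: "('a \<Rightarrow>\<^sub>0 'b) \<Rightarrow> ('a \<Rightarrow>\<^sub>0 'b) \<Rightarrow> real" where
  "inner x y = (\<Sum>k\<in>keys x. inner (lookup x k) (lookup y k))"

definition norm_poly_mapping :: "('a \<Rightarrow>\<^sub>0 'b) \<Rightarrow> real" where
  "norm_poly_mapping x = sqrt (inner x x)"

definition sgn_poly_mapping :: "('a \<Rightarrow>\<^sub>0 'b) \<Rightarrow> 'a \<Rightarrow>\<^sub>0 'b" where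
  "sgn_poly_mapping x = inverse (norm x) *\<^sub>R x"

definition dist_poly_mapping :: "('a \<Rightarrow>\<^sub>0 'b) \<Rightarrow> ('a \<Rightarrow>\<^sub>0 'b) \<Rightarrow> real" where
  "dist_poly_mapping x y = norm (x - y)"

definition uniformity_poly_mapping :: "(('a \<Rightarrow>\<^sub>0 'b) \<times> ('a \<Rightarrow>\<^sub>0 'b)) filter" where
  "uniformity_poly_mapping = (INF e\<in>{0<..}. principal {(x, y :: 'a \<Rightarrow>\<^sub>0 'b). dist x y < e})"

definition open_poly_mapping :: "('a \<Rightarrow>\<^sub>0 'b) set \<Rightarrow> bool" where
  "open_poly_mapping U \<longleftrightarrow> (\<forall>x\<in>U. eventually (\<lambda>(x', y :: 'a \<Rightarrow>\<^sub>0 'b). x' = x \<longrightarrow> y \<in> U) uniformity)"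

lemma inner_poly_mapping_superset:
  fixes x y :: "'a \<Rightarrow>\<^sub>0 'b"
  assumes "finite I" "keys x \<subseteq> I"
  shows "inner x y = (\<Sum>k\<in>I. inner (lookup x k) (lookup y k))"
  unfolding inner_poly_mapping_def using assms
  by (intro sum.mono_neutral_left) (auto simp: in_keys_iff)

instance
proof
  fix x y z :: "'a \<Rightarrow>\<^sub>0 'b" and c :: real
  \<comment> \<open>A common finite index set for all supports, so that the sums can be compared
    termwise.\<close>
  define I where "I = keys x \<union> keys y \<union> keys z"
  have I: "finite I" "keys x \<subseteq> I" "keys y \<subseteq> I" "keys (x + y) \<subseteq> I" "keys (c *\<^sub>R x) \<subseteq> I"
    by (auto simp: I_def in_keys_iff lookup_add)
  note sup = inner_poly_mapping_superset[OF I(1)]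
  show "inner x y = inner y x"
    by (simp add: sup I inner_commute)
  show "inner (x + y) z = inner x z + inner y z"
    by (simp add: sup I lookup_add inner_add_left sum.distrib)
  show "inner (c *\<^sub>R x) y = c * inner x y"
    by (simp add: sup I sum_distrib_left)
  show "0 \<le> inner x x"
    by (simp add: inner_poly_mapping_def sum_nonneg)
  show "inner x x = 0 \<longleftrightarrow> x = 0"
  proof
    assume "inner x x = 0"
    then have "\<forall>k\<in>keys x. inner (lookup x k) (lookup x k) = 0"
      by (simp add: inner_poly_mapping_def sum_nonneg_eq_0_iff)
    then show "x = 0"
      by (intro poly_mapping_eqI) (auto simp: in_keys_iff)
  qed (simp add: inner_poly_mapping_def)
qed (simp_all only: norm_poly_mapping_def sgn_poly_mapping_def dist_poly_mapping_def
    uniformity_poly_mapping_def open_poly_mapping_def)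

end

text \<open>The block operators below are given by their coordinates through \<open>fam\<close> over
  a fixed finite set, which alone makes them finite-rank.\<close>

definition fam :: "'i set \<Rightarrow> ('i \<Rightarrow> real) \<Rightarrow> 'i \<Rightarrow>\<^sub>0 real" where
  "fam I g = (\<Sum>i\<in>I. Poly_Mapping.single i (g i))"

lemma lookup_fam: "finite I \<Longrightarrow> lookup (fam I g) i = (if i \<in> I then g i else 0)"
  by (simp add: fam_def lookup_sum lookup_single when_def)

lemma fam_cong: "(\<And>i. i \<in> I \<Longrightarrow> g i = h i) \<Longrightarrow> fam I g = fam I h"
  by (simp add: fam_def)

lemma fam_add: "fam I (\<lambda>i. g i + h i) = fam I g + fam I h"
  by (simp add: fam_def single_add sum.distrib)

lemma fam_uminus: "fam I (\<lambda>i. - g i) = - fam I g"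
  by (simp add: fam_def single_uminus sum_negf)

lemma fam_diff: "fam I (\<lambda>i. g i - h i) = fam I g - fam I h"
  by (simp add: fam_def single_diff sum_subtractf)

lemma fam_eq_scaleR: "fam I g = (\<Sum>i\<in>I. g i *\<^sub>R Poly_Mapping.single i 1)"
  unfolding fam_def
  by (intro sum.cong refl poly_mapping_eqI) (simp add: lookup_single when_def)

lemma inner_fam:
  assumes "finite I"
  shows "inner (fam I g) y = (\<Sum>i\<in>I. g i * lookup y i)"
proof -
  have "keys (fam I g) \<subseteq> I"
    using assms by (auto simp: in_keys_iff lookup_fam split: if_splits)
  then show ?thesis
    using assms by (simp add: inner_poly_mapping_superset[OF assms] lookup_fam)
qed

lemma finite_rank_fam:
  assumes "finite I"
  shows "finite_rank (\<lambda>x. fam I (g x))"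
  unfolding finite_rank_def fam_eq_scaleR
  using assms
  by (intro exI[of _ "(\<lambda>i. Poly_Mapping.single i 1) ` I"] conjI allI span_sum span_scale) (auto intro: span_base)

lemma fam_has_vector_derivative:
  assumes "\<And>i. i \<in> I \<Longrightarrow> ((\<lambda>t. g t i) has_real_derivative g' i) (at t within A)"
  shows "((\<lambda>t. fam I (g t)) has_vector_derivative fam I g') (at t within A)"
proof -
  have "((\<lambda>t. g t i *\<^sub>R (Poly_Mapping.single i 1 :: _ \<Rightarrow>\<^sub>0 real)) has_vector_derivative
      g' i *\<^sub>R Poly_Mapping.single i 1) (at t within A)" if "i \<in> I" for i
  proof -
    have "((\<lambda>t. g t i) has_vector_derivative g' i) (at t within A)"
      using assms[OF that] by (simp only: has_real_derivative_iff_has_vector_derivative)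
    then show ?thesis
      by (rule bounded_linear.has_vector_derivative[OF bounded_linear_scaleR_left])
  qed
  then show ?thesis
    unfolding fam_eq_scaleR
    by (rule has_vector_derivative_sum[of I "\<lambda>i t. g t i *\<^sub>R Poly_Mapping.single i 1"])
qed

section \<open>Block operators on families of matrices\<close>

text \<open>Coordinates are indexed by agent, row and column, so that matrices whose sizes depend on
  the agent share one type.\<close>

type_synonym family = "nat \<times> nat \<times> nat \<Rightarrow>\<^sub>0 real"

definition cells :: "nat \<Rightarrow> (nat \<Rightarrow> nat) \<Rightarrow> (nat \<Rightarrow> nat) \<Rightarrow> (nat \<times> nat \<times> nat) set" where
  "cells n d e = (SIGMA i:{..<n}. {..<d i} \<times> {..<e i})"

lemma finite_cells [simp]: "finite (cells n d e)"
  by (simp add: cells_def)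

lemma in_cells [simp]: "(i, k, l) \<in> cells n d e \<longleftrightarrow> i < n \<and> k < d i \<and> l < e i"
  by (auto simp: cells_def)

lemma sum_cells: "(\<Sum>c\<in>cells n d e. g c) = (\<Sum>i<n. \<Sum>k<d i. \<Sum>l<e i. g (i, k, l))"
proof -
  have "(\<Sum>c\<in>cells n d e. g c) = (\<Sum>i<n. \<Sum>kl\<in>{..<d i} \<times> {..<e i}. g (i, kl))"
    unfolding cells_def by (subst sum.Sigma) auto
  also have "\<dots> = (\<Sum>i<n. \<Sum>k<d i. \<Sum>l<e i. g (i, k, l))"
    by (intro sum.cong refl) (simp add: sum.cartesian_product split_def)
  finally show ?thesis .
qed

definition stack :: "nat \<Rightarrow> (nat \<Rightarrow> nat) \<Rightarrow> (nat \<Rightarrow> nat) \<Rightarrow> (nat \<Rightarrow> real mat) \<Rightarrow> family" where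
  "stack n d e Z = fam (cells n d e) (\<lambda>(i, k, l). Z i $$ (k, l))"

definition unstack :: "(nat \<Rightarrow> nat) \<Rightarrow> (nat \<Rightarrow> nat) \<Rightarrow> family \<Rightarrow> nat \<Rightarrow> real mat" where
  "unstack d e x i = Matrix.mat (d i) (e i) (\<lambda>(k, l). lookup x (i, k, l))"

lemma lookup_stack:
  "lookup (stack n d e Z) (i, k, l) = (if i < n \<and> k < d i \<and> l < e i then Z i $$ (k, l) else 0)"
  by (simp add: stack_def lookup_fam)

lemma stack_cong:
  assumes "\<And>i k l. i < n \<Longrightarrow> k < d i \<Longrightarrow> l < e i \<Longrightarrow> Z i $$ (k, l) = W i $$ (k, l)"
  shows "stack n d e Z = stack n d e W"
  unfolding stack_def using assms by (intro fam_cong) auto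

lemma unstack_carrier [simp]: "unstack d e x i \<in> carrier_mat (d i) (e i)"
  by (simp add: unstack_def)

lemma stack_unstack:
  assumes "\<And>c. c \<notin> cells n d e \<Longrightarrow> lookup x c = 0"
  shows "stack n d e (unstack d e x) = x"
proof (rule poly_mapping_eqI)
  show "lookup (stack n d e (unstack d e x)) c = lookup x c" for c
    using assms[of c] by (cases c) (auto simp: lookup_stack unstack_def)
qed

lemma stack_add:
  assumes "\<And>i. i < n \<Longrightarrow> W i \<in> carrier_mat (d i) (e i)"
  shows "stack n d e (\<lambda>i. Z i + W i) = stack n d e Z + stack n d e W"
proof -
  have "stack n d e (\<lambda>i. Z i + W i) = fam (cells n d e)
      (\<lambda>c. (case c of (i, k, l) \<Rightarrow> Z i $$ (k, l)) + (case c of (i, k, l) \<Rightarrow> W i $$ (k, l)))"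
    unfolding stack_def using carrier_matD[OF assms] by (intro fam_cong) auto
  then show ?thesis
    by (simp add: stack_def fam_add)
qed

lemma stack_uminus:
  assumes "\<And>i. i < n \<Longrightarrow> Z i \<in> carrier_mat (d i) (e i)"
  shows "stack n d e (\<lambda>i. - Z i) = - stack n d e Z"
proof -
  have "stack n d e (\<lambda>i. - Z i) = fam (cells n d e)
      (\<lambda>c. - (case c of (i, k, l) \<Rightarrow> Z i $$ (k, l)))"
    unfolding stack_def using carrier_matD[OF assms] by (intro fam_cong) auto
  then show ?thesis
    by (simp add: stack_def fam_uminus)
qed

lemma stack_diff:
  assumes "\<And>i. i < n \<Longrightarrow> W i \<in> carrier_mat (d i) (e i)"
  shows "stack n d e (\<lambda>i. Z i - W i) = stack n d e Z - stack n d e W"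
proof -
  have "stack n d e (\<lambda>i. Z i - W i) = fam (cells n d e)
      (\<lambda>c. (case c of (i, k, l) \<Rightarrow> Z i $$ (k, l)) - (case c of (i, k, l) \<Rightarrow> W i $$ (k, l)))"
    unfolding stack_def using carrier_matD[OF assms] by (intro fam_cong) auto
  then show ?thesis
    by (simp add: stack_def fam_diff)
qed

lemma stack_eq_0_iff:
  assumes "\<And>i. i < n \<Longrightarrow> Z i \<in> carrier_mat (d i) (e i)"
  shows "stack n d e Z = 0 \<longleftrightarrow> (\<forall>i<n. Z i = 0\<^sub>m (d i) (e i))"
proof
  assume 0: "stack n d e Z = 0"
  show "\<forall>i<n. Z i = 0\<^sub>m (d i) (e i)"
  proof (intro allI impI eq_matI)
    fix i k l
    assume "i < n" "k < dim_row (0\<^sub>m (d i) (e i) :: real mat)" "l < dim_col (0\<^sub>m (d i) (e i) :: real mat)"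
    then show "Z i $$ (k, l) = 0\<^sub>m (d i) (e i) $$ (k, l)"
      using lookup_stack[of n d e Z i k l] by (simp add: 0)
  qed (use carrier_matD[OF assms] in auto)
next
  assume "\<forall>i<n. Z i = 0\<^sub>m (d i) (e i)"
  then show "stack n d e Z = 0"
    by (intro poly_mapping_eqI) (auto simp: lookup_stack)
qed

lemma stack_has_vector_derivative:
  assumes "\<And>i. i < n \<Longrightarrow> has_mat_derivative (\<lambda>t. Z t i) (D i) (at t within A)"
    and "\<And>i. i < n \<Longrightarrow> D i \<in> carrier_mat (d i) (e i)"
  shows "((\<lambda>t. stack n d e (Z t)) has_vector_derivative stack n d e D) (at t within A)"
  unfolding stack_def using assms(1) carrier_matD[OF assms(2)]
  by (intro fam_has_vector_derivative) (auto simp: has_mat_derivative_def)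

lemma frobenius_norm_square:
  "(frobenius_norm M)\<^sup>2 = (\<Sum>k<dim_row M. \<Sum>l<dim_col M. (M $$ (k, l))\<^sup>2)"
  by (simp add: frobenius_norm_def sum_nonneg)

lemma norm_stack_square:
  assumes "\<And>i. i < n \<Longrightarrow> Z i \<in> carrier_mat (d i) (e i)"
  shows "(norm (stack n d e Z))\<^sup>2 = (\<Sum>i<n. (frobenius_norm (Z i))\<^sup>2)"
proof -
  have "(norm (stack n d e Z))\<^sup>2 = inner (stack n d e Z) (stack n d e Z)"
    by (simp add: dot_square_norm)
  also have "\<dots> = (\<Sum>i<n. \<Sum>k<d i. \<Sum>l<e i. Z i $$ (k, l) * Z i $$ (k, l))"
    by (subst (1) stack_def) (simp add: inner_fam sum_cells lookup_stack)
  also have "\<dots> = (\<Sum>i<n. (frobenius_norm (Z i))\<^sup>2)"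
    using carrier_matD[OF assms]
    by (intro sum.cong) (auto simp: frobenius_norm_square power2_eq_square[of "_ $$ _"])
  finally show ?thesis .
qed

section \<open>Blockwise multiplication from the left and from the right\<close>

definition left_mult :: "nat \<Rightarrow> (nat \<Rightarrow> nat) \<Rightarrow> (nat \<Rightarrow> nat) \<Rightarrow> nat \<Rightarrow> (nat \<Rightarrow> real mat) \<Rightarrow> family \<Rightarrow> family"
  where "left_mult n d1 d2 e P x =
    fam (cells n d1 (\<lambda>_. e)) (\<lambda>(i, k, l). \<Sum>h<d2 i. P i $$ (k, h) * lookup x (i, h, l))"

definition right_mult :: "nat \<Rightarrow> nat \<Rightarrow> (nat \<Rightarrow> nat) \<Rightarrow> (nat \<Rightarrow> nat) \<Rightarrow> (nat \<Rightarrow> real mat) \<Rightarrow> family \<Rightarrow> family"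
  where "right_mult n d e1 e2 P x =
    fam (cells n (\<lambda>_. d) e2) (\<lambda>(i, k, l). \<Sum>h<e1 i. lookup x (i, k, h) * P i $$ (h, l))"

lemma left_mult_stack:
  assumes "\<And>i. i < n \<Longrightarrow> P i \<in> carrier_mat (d1 i) (d2 i)"
    and "\<And>i. i < n \<Longrightarrow> Z i \<in> carrier_mat (d2 i) e"
  shows "left_mult n d1 d2 e P (stack n d2 (\<lambda>_. e) Z) = stack n d1 (\<lambda>_. e) (\<lambda>i. P i * Z i)"
proof -
  have "(P i * Z i) $$ (k, l) = (\<Sum>h<d2 i. P i $$ (k, h) * Z i $$ (h, l))"
    if "i < n" "k < d1 i" "l < e" for i k l
    using that carrier_matD[OF assms(1)[OF that(1)]] carrier_matD[OF assms(2)[OF that(1)]]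
    by (simp add: scalar_prod_def atLeast0LessThan)
  then show ?thesis
    unfolding left_mult_def stack_def[of n d1] by (intro fam_cong) (auto simp: lookup_stack)
qed

lemma right_mult_stack:
  assumes "\<And>i. i < n \<Longrightarrow> P i \<in> carrier_mat (e1 i) (e2 i)"
    and "\<And>i. i < n \<Longrightarrow> Z i \<in> carrier_mat d (e1 i)"
  shows "right_mult n d e1 e2 P (stack n (\<lambda>_. d) e1 Z) = stack n (\<lambda>_. d) e2 (\<lambda>i. Z i * P i)"
proof -
  have "(Z i * P i) $$ (k, l) = (\<Sum>h<e1 i. Z i $$ (k, h) * P i $$ (h, l))"
    if "i < n" "k < d" "l < e2 i" for i k l
    using that carrier_matD[OF assms(1)[OF that(1)]] carrier_matD[OF assms(2)[OF that(1)]]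
    by (simp add: scalar_prod_def atLeast0LessThan)
  then show ?thesis
    unfolding right_mult_def stack_def[of n _ e2] by (intro fam_cong) (auto simp: lookup_stack)
qed

text \<open>Transposition exchanges the roles of \<open>k\<close> and \<open>h\<close> in the
  fourfold sum. Coordinates outside the cells are neither read nor written, so the identity holds
  for all families.\<close>

lemma finite_rank_adjoint_left_mult:
  assumes "\<And>i. i < n \<Longrightarrow> P i \<in> carrier_mat (d1 i) (d2 i)"
  shows "finite_rank_adjoint (left_mult n d1 d2 e P) (left_mult n d2 d1 e (\<lambda>i. transpose_mat (P i)))"
proof
  fix x y :: family
  have "inner (left_mult n d1 d2 e P x) y =
      (\<Sum>i<n. \<Sum>k<d1 i. \<Sum>l<e. \<Sum>h<d2 i. P i $$ (k, h) * lookup x (i, h, l) * lookup y (i, k, l))"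
    by (simp add: left_mult_def inner_fam sum_cells sum_distrib_right)
  also have "\<dots> = (\<Sum>i<n. \<Sum>h<d2 i. \<Sum>l<e. \<Sum>k<d1 i.
      P i $$ (k, h) * lookup x (i, h, l) * lookup y (i, k, l))"
  proof (rule sum.cong[OF refl])
    fix i
    let ?T = "\<lambda>k h l. P i $$ (k, h) * lookup x (i, h, l) * lookup y (i, k, l)"
    have "(\<Sum>k<d1 i. \<Sum>l<e. \<Sum>h<d2 i. ?T k h l) = (\<Sum>k<d1 i. \<Sum>h<d2 i. \<Sum>l<e. ?T k h l)"
      by (rule sum.cong[OF refl], rule sum.swap)
    also have "\<dots> = (\<Sum>h<d2 i. \<Sum>k<d1 i. \<Sum>l<e. ?T k h l)"
      by (rule sum.swap)
    also have "\<dots> = (\<Sum>h<d2 i. \<Sum>l<e. \<Sum>k<d1 i. ?T k h l)"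
      by (rule sum.cong[OF refl], rule sum.swap)
    finally show "(\<Sum>k<d1 i. \<Sum>l<e. \<Sum>h<d2 i. ?T k h l) = (\<Sum>h<d2 i. \<Sum>l<e. \<Sum>k<d1 i. ?T k h l)" .
  qed
  also have "\<dots> = inner (left_mult n d2 d1 e (\<lambda>i. transpose_mat (P i)) y) x"
    using carrier_matD[OF assms]
    by (auto simp: left_mult_def inner_fam sum_cells sum_distrib_right sum_distrib_left mult_ac intro!: sum.cong)
  finally show "inner (left_mult n d1 d2 e P x) y =
      inner x (left_mult n d2 d1 e (\<lambda>i. transpose_mat (P i)) y)"
    by (simp only: inner_commute)
next
  show "finite_rank (left_mult n d1 d2 e P)"
    unfolding left_mult_def by (rule finite_rank_fam) simp
qed

lemma finite_rank_adjoint_right_mult: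
  assumes "\<And>i. i < n \<Longrightarrow> P i \<in> carrier_mat (e1 i) (e2 i)"
  shows "finite_rank_adjoint (right_mult n d e1 e2 P)
    (right_mult n d e2 e1 (\<lambda>i. transpose_mat (P i)))"
proof
  fix x y :: family
  have "inner (right_mult n d e1 e2 P x) y =
      (\<Sum>i<n. \<Sum>k<d. \<Sum>l<e2 i. \<Sum>h<e1 i. lookup x (i, k, h) * P i $$ (h, l) * lookup y (i, k, l))"
    by (simp add: right_mult_def inner_fam sum_cells sum_distrib_right)
  also have "\<dots> = (\<Sum>i<n. \<Sum>k<d. \<Sum>h<e1 i. \<Sum>l<e2 i.
      lookup x (i, k, h) * P i $$ (h, l) * lookup y (i, k, l))"
    by (rule sum.cong[OF refl], rule sum.cong[OF refl], rule sum.swap)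
  also have "\<dots> = inner (right_mult n d e2 e1 (\<lambda>i. transpose_mat (P i)) y) x"
    using carrier_matD[OF assms]
    by (auto simp: right_mult_def inner_fam sum_cells sum_distrib_right sum_distrib_left mult_ac intro!: sum.cong)
  finally show "inner (right_mult n d e1 e2 P x) y =
      inner x (right_mult n d e2 e1 (\<lambda>i. transpose_mat (P i)) y)"
    by (simp only: inner_commute)
next
  show "finite_rank (right_mult n d e1 e2 P)"
    unfolding right_mult_def by (rule finite_rank_fam) simp
qed

lemma finite_rank_adjoint_left_mult_transpose:
  assumes "\<And>i. i < n \<Longrightarrow> P i \<in> carrier_mat (d1 i) (d2 i)"
  shows "finite_rank_adjoint (left_mult n d2 d1 e (\<lambda>i. transpose_mat (P i))) (left_mult n d1 d2 e P)"
  using finite_rank_adjoint_left_mult[of n "\<lambda>i. transpose_mat (P i)" d2 d1 e] assms by simp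

lemma finite_rank_adjoint_right_mult_transpose:
  assumes "\<And>i. i < n \<Longrightarrow> P i \<in> carrier_mat (e1 i) (e2 i)"
  shows "finite_rank_adjoint (right_mult n d e2 e1 (\<lambda>i. transpose_mat (P i))) (right_mult n d e1 e2 P)"
  using finite_rank_adjoint_right_mult[of n "\<lambda>i. transpose_mat (P i)" e2 e1 d] assms by simp

lemma lookup_outside_cells:
  "c \<notin> cells n d e \<Longrightarrow> lookup (stack n d e Z) c = 0"
  "c \<notin> cells n d1 (\<lambda>_. j) \<Longrightarrow> lookup (left_mult n d1 d2 j P x) c = 0"
  "c \<notin> cells n (\<lambda>_. k) e2 \<Longrightarrow> lookup (right_mult n k e1 e2 P x) c = 0"
  by (simp_all add: stack_def left_mult_def right_mult_def lookup_fam)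

section \<open>The weighted graph Laplacian, acting entrywise on families of matrices\<close>

definition laplacian :: "nat \<Rightarrow> nat \<Rightarrow> nat \<Rightarrow> real mat \<Rightarrow> family \<Rightarrow> family" where
  "laplacian n d e a x = fam (cells n (\<lambda>_. d) (\<lambda>_. e))
     (\<lambda>(i, k, l). \<Sum>j<n. a $$ (i, j) * (lookup x (i, k, l) - lookup x (j, k, l)))"

lemma laplacian_stack:
  assumes "\<And>i. i < n \<Longrightarrow> Z i \<in> carrier_mat d e" and "dim_row a = n"
  shows "laplacian n d e a (stack n (\<lambda>_. d) (\<lambda>_. e) Z) = stack n (\<lambda>_. d) (\<lambda>_. e) (coupling a Z)"
  unfolding laplacian_def stack_def[of n _ _ "coupling a Z"] using carrier_matD[OF assms(1)] assms(2)
  by (intro fam_cong) (auto simp: lookup_stack coupling_def)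

lemma laplacian_const: "laplacian n d e a (stack n (\<lambda>_. d) (\<lambda>_. e) (\<lambda>_. Z)) = 0"
proof (rule poly_mapping_eqI)
  show "lookup (laplacian n d e a (stack n (\<lambda>_. d) (\<lambda>_. e) (\<lambda>_. Z))) c = lookup 0 c" for c
    by (cases c) (simp add: laplacian_def lookup_fam lookup_stack)
qed

lemma lookup_laplacian_outside_cells:
  "c \<notin> cells n (\<lambda>_. d) (\<lambda>_. e) \<Longrightarrow> lookup (laplacian n d e a x) c = 0"
  by (simp add: laplacian_def lookup_fam)

text \<open>Exchanging \<open>i\<close> and \<open>j\<close> reverses the sign of the difference, so
  the sum weighted with \<open>v j\<close> is minus the one weighted with \<open>v i\<close>; hence
  the factor 2.\<close>

lemma laplacian_form:
  fixes a :: "nat \<Rightarrow> nat \<Rightarrow> real"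
  assumes "\<And>i j. i < n \<Longrightarrow> j < n \<Longrightarrow> a i j = a j i"
  shows "(\<Sum>i<n. (\<Sum>j<n. a i j * (u i - u j)) * v i) =
    (\<Sum>i<n. \<Sum>j<n. a i j * (u i - u j) * (v i - v j)) / 2"
proof -
  have "(\<Sum>i<n. \<Sum>j<n. a i j * (u i - u j) * v j) = (\<Sum>j<n. \<Sum>i<n. a i j * (u i - u j) * v j)"
    by (rule sum.swap)
  also have "\<dots> = (\<Sum>j<n. \<Sum>i<n. - (a j i * (u j - u i) * v j))"
    using assms by (intro sum.cong refl) (auto simp: algebra_simps)
  also have "\<dots> = - (\<Sum>i<n. \<Sum>j<n. a i j * (u i - u j) * v i)"
    by (simp add: sum_negf)
  finally have "(\<Sum>i<n. \<Sum>j<n. a i j * (u i - u j) * (v i - v j)) =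
      2 * (\<Sum>i<n. \<Sum>j<n. a i j * (u i - u j) * v i)"
    by (simp only: right_diff_distrib[of "a _ _ * _"] sum_subtractf)
  then show ?thesis
    by (simp add: sum_distrib_right)
qed

locale symmetric_weights =
  fixes n :: nat and a :: "real mat"
  assumes symmetric: "i < n \<Longrightarrow> j < n \<Longrightarrow> a $$ (i, j) = a $$ (j, i)"
    and nonneg: "i < n \<Longrightarrow> j < n \<Longrightarrow> 0 \<le> a $$ (i, j)"
begin

lemma inner_laplacian:
  "inner (laplacian n d e a x) y = (\<Sum>k<d. \<Sum>l<e. (\<Sum>i<n. \<Sum>j<n.
     a $$ (i, j) * (lookup x (i, k, l) - lookup x (j, k, l)) *
       (lookup y (i, k, l) - lookup y (j, k, l))) / 2)"
proof -
  have "inner (laplacian n d e a x) y = (\<Sum>i<n. \<Sum>k<d. \<Sum>l<e.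
      (\<Sum>j<n. a $$ (i, j) * (lookup x (i, k, l) - lookup x (j, k, l))) * lookup y (i, k, l))"
    by (simp add: laplacian_def inner_fam sum_cells)
  also have "\<dots> = (\<Sum>k<d. \<Sum>i<n. \<Sum>l<e.
      (\<Sum>j<n. a $$ (i, j) * (lookup x (i, k, l) - lookup x (j, k, l))) * lookup y (i, k, l))"
    by (rule sum.swap)
  also have "\<dots> = (\<Sum>k<d. \<Sum>l<e. \<Sum>i<n.
      (\<Sum>j<n. a $$ (i, j) * (lookup x (i, k, l) - lookup x (j, k, l))) * lookup y (i, k, l))"
    by (rule sum.cong[OF refl], rule sum.swap)
  also have "\<dots> = (\<Sum>k<d. \<Sum>l<e. (\<Sum>i<n. \<Sum>j<n.
     a $$ (i, j) * (lookup x (i, k, l) - lookup x (j, k, l)) *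
       (lookup y (i, k, l) - lookup y (j, k, l))) / 2)"
    by (intro sum.cong refl laplacian_form) (rule symmetric)
  finally show ?thesis .
qed

lemma finite_rank_adjoint_laplacian:
  "finite_rank_adjoint (laplacian n d e a) (laplacian n d e a)"
proof
  show "inner (laplacian n d e a x) y = inner x (laplacian n d e a y)" for x y
    unfolding inner_commute[of x] inner_laplacian by (simp only: mult_ac)
  show "finite_rank (laplacian n d e a)"
    unfolding laplacian_def by (rule finite_rank_fam) simp
qed

lemma laplacian_psd:
  "0 \<le> inner (laplacian n d e a x) x"
  unfolding inner_laplacian mult.assoc
  by (intro sum_nonneg divide_nonneg_nonneg mult_nonneg_nonneg[OF nonneg zero_le_square]) auto

text \<open>The Dirichlet form of \<open>x\<close> vanishes and is a sum of nonnegative terms, so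
  every term is 0; the four sums are peeled off one after another.\<close>

lemma laplacian_kernel:
  assumes x: "laplacian n d e a x = 0"
    and ij: "i < n" "j < n" "a $$ (i, j) > 0" and kl: "k < d" "l < e"
  shows "lookup x (i, k, l) = lookup x (j, k, l)"
proof -
  let ?q = "\<lambda>k l i j. a $$ (i, j) * ((lookup x (i, k, l) - lookup x (j, k, l)) *
       (lookup x (i, k, l) - lookup x (j, k, l)))"
  have q: "0 \<le> ?q k l i j" if "i < n" "j < n" for k l i j
    using nonneg[OF that] by simp
  have "(\<Sum>k<d. \<Sum>l<e. (\<Sum>i<n. \<Sum>j<n. ?q k l i j) / 2) = 0"
    using inner_laplacian[of d e x x] by (simp add: x mult.assoc)
  then have "\<forall>k\<in>{..<d}. (\<Sum>l<e. (\<Sum>i<n. \<Sum>j<n. ?q k l i j) / 2) = 0"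
    by (subst (asm) sum_nonneg_eq_0_iff) (auto intro!: sum_nonneg simp: q)
  then have "(\<Sum>l<e. (\<Sum>i<n. \<Sum>j<n. ?q k l i j) / 2) = 0"
    using kl by blast
  then have "\<forall>l\<in>{..<e}. (\<Sum>i<n. \<Sum>j<n. ?q k l i j) / 2 = 0"
    by (subst (asm) sum_nonneg_eq_0_iff) (auto intro!: sum_nonneg simp: q)
  then have "(\<Sum>i<n. \<Sum>j<n. ?q k l i j) = 0"
    using kl by auto
  then have "\<forall>i\<in>{..<n}. (\<Sum>j<n. ?q k l i j) = 0"
    by (subst (asm) sum_nonneg_eq_0_iff) (auto intro!: sum_nonneg simp: q)
  then have "(\<Sum>j<n. ?q k l i j) = 0"
    using ij by blast
  then have "\<forall>j\<in>{..<n}. ?q k l i j = 0"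
    by (subst (asm) sum_nonneg_eq_0_iff) (use ij in \<open>auto simp: q\<close>)
  then show ?thesis
    using ij by (auto dest!: bspec[where x = j])
qed

end

section \<open>Partitions of indices and matrices into consecutive blocks\<close>

lemma sum_blocks:
  fixes d :: "nat \<Rightarrow> nat" and g :: "nat \<Rightarrow> real"
  shows "(\<Sum>c<(\<Sum>i<n. d i). g c) = (\<Sum>i<n. \<Sum>l<d i. g ((\<Sum>j<i. d j) + l))"
proof (induction n)
  case (Suc n)
  have "(\<Sum>c<a + b. g c) = (\<Sum>c<a. g c) + (\<Sum>l<b. g (a + l))" for a b
    by (induction b) auto
  then show ?case
    using Suc.IH by simp
qed simp

lemma block_index:
  fixes d :: "nat \<Rightarrow> nat"
  assumes "c < (\<Sum>i<n. d i)"
  shows "\<exists>i<n. \<exists>k<d i. c = (\<Sum>j<i. d j) + k"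
  using assms
proof (induction n)
  case (Suc n)
  show ?case
  proof (cases "c < (\<Sum>i<n. d i)")
    case True
    then show ?thesis
      using Suc.IH[OF True] by (auto intro: less_SucI)
  next
    case False
    then show ?thesis
      using Suc.prems by (intro exI[of _ n] conjI exI[of _ "c - (\<Sum>i<n. d i)"]) auto
  qed
qed simp

lemma frobenius_norm_col_blocks:
  assumes "dim_col M = (\<Sum>i<n. qs i)"
  shows "(\<Sum>i<n. (frobenius_norm (col_block qs M i))\<^sup>2) = (frobenius_norm M)\<^sup>2"
proof -
  have "(frobenius_norm M)\<^sup>2 = (\<Sum>k<dim_row M. \<Sum>i<n. \<Sum>l<qs i. (M $$ (k, (\<Sum>j<i. qs j) + l))\<^sup>2)"
    by (simp add: frobenius_norm_square assms sum_blocks)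
  also have "\<dots> = (\<Sum>i<n. \<Sum>k<dim_row M. \<Sum>l<qs i. (M $$ (k, (\<Sum>j<i. qs j) + l))\<^sup>2)"
    by (rule sum.swap)
  also have "\<dots> = (\<Sum>i<n. (frobenius_norm (col_block qs M i))\<^sup>2)"
    by (intro sum.cong) (auto simp: frobenius_norm_square col_block_def)
  finally show ?thesis by simp
qed

lemma col_block_mult_diff:
  assumes "Y \<in> carrier_mat m p" "B \<in> carrier_mat p (\<Sum>i<n. qs i)" "F \<in> carrier_mat m (\<Sum>i<n. qs i)"
    and "i < n"
  shows "Y * col_block qs B i - col_block qs F i = col_block qs (Y * B - F) i"
proof (rule eq_matI)
  fix k l
  assume "k < dim_row (col_block qs (Y * B - F) i)" "l < dim_col (col_block qs (Y * B - F) i)"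
  then have kl: "k < m" "l < qs i"
    using assms by (auto simp: col_block_def)
  moreover have "(\<Sum>j<i. qs j) + l < (\<Sum>j<n. qs j)"
    using block_end_le[OF assms(4), of qs] kl by linarith
  ultimately show "(Y * col_block qs B i - col_block qs F i) $$ (k, l) =
      col_block qs (Y * B - F) i $$ (k, l)"
    using assms by (simp add: col_block_def scalar_prod_def)
qed (use assms in \<open>auto simp: col_block_def\<close>)

lemma row_block_mult:
  assumes "A \<in> carrier_mat (\<Sum>i<n. ms i) r" "X \<in> carrier_mat r p" and "i < n"
  shows "row_block ms A i * X = row_block ms (A * X) i"
proof (rule eq_matI)
  fix k l
  assume "k < dim_row (row_block ms (A * X) i)" "l < dim_col (row_block ms (A * X) i)"
  then have kl: "k < ms i" "l < p"
    using assms by (auto simp: row_block_def)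
  moreover have "(\<Sum>j<i. ms j) + k < (\<Sum>j<n. ms j)"
    using block_end_le[OF assms(3), of ms] kl by linarith
  ultimately show "(row_block ms A i * X) $$ (k, l) = row_block ms (A * X) i $$ (k, l)"
    using assms by (simp add: row_block_def scalar_prod_def)
qed (use assms in \<open>auto simp: row_block_def\<close>)

lemma eq_if_row_blocks_eq:
  assumes "M \<in> carrier_mat (\<Sum>i<n. ms i) p" "N \<in> carrier_mat (\<Sum>i<n. ms i) p"
    and eq: "\<And>i. i < n \<Longrightarrow> row_block ms M i = row_block ms N i"
  shows "M = N"
proof (rule eq_matI)
  fix c l assume "c < dim_row N" "l < dim_col N"
  then have c: "c < (\<Sum>i<n. ms i)" and l: "l < p"
    using assms(2) by auto
  obtain i k where ik: "i < n" "k < ms i" "c = (\<Sum>j<i. ms j) + k"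
    using block_index[OF c] by blast
  show "M $$ (c, l) = N $$ (c, l)"
    using arg_cong[OF eq[OF ik(1)], of "\<lambda>Q. Q $$ (k, l)"] assms(1,2) ik l
    by (simp add: row_block_def)
qed (use assms in auto)

text \<open>Writing the extraction of a row-block as a product exhibits it as the adjoint of
  multiplication by \<open>id_row_block\<close>.\<close>

lemma id_row_block_transpose_mult:
  assumes "Y \<in> carrier_mat (\<Sum>j<n. ms j) p" "i < n"
  shows "transpose_mat (id_row_block n ms i) * Y = row_block ms Y i"
proof (rule eq_matI)
  fix k l
  assume "k < dim_row (row_block ms Y i)" "l < dim_col (row_block ms Y i)"
  then have kl: "k < ms i" "l < p"
    using assms by (auto simp: row_block_def)
  have lt: "(\<Sum>j<i. ms j) + k < (\<Sum>j<n. ms j)"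
    using block_end_le[OF assms(2), of ms] kl by linarith
  have "(transpose_mat (id_row_block n ms i) * Y) $$ (k, l) =
      (\<Sum>h\<in>{0..<(\<Sum>j<n. ms j)}. (if h = (\<Sum>j<i. ms j) + k then 1 else 0) * Y $$ (h, l))"
    using assms kl by (simp add: id_row_block_def scalar_prod_def)
  also have "\<dots> = (\<Sum>h\<in>{0..<(\<Sum>j<n. ms j)}. if h = (\<Sum>j<i. ms j) + k then Y $$ (h, l) else 0)"
    by (rule sum.cong) auto
  also have "\<dots> = Y $$ ((\<Sum>j<i. ms j) + k, l)"
    using lt by simp
  finally show "(transpose_mat (id_row_block n ms i) * Y) $$ (k, l) = row_block ms Y i $$ (k, l)"
    using assms kl by (simp add: row_block_def)
qed (use assms in \<open>auto simp: row_block_def id_row_block_def\<close>)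

section \<open>The network\<close>

lemma has_vector_derivative_Pair:
  assumes "(f has_vector_derivative f') (at t within T)" and "(g has_vector_derivative g') (at t within T)"
  shows "((\<lambda>t. (f t, g t)) has_vector_derivative (f', g')) (at t within T)"
  using has_derivative_Pair[OF assms[unfolded has_vector_derivative_def]]
  by (simp add: has_vector_derivative_def)

lemma exponentially_decaying_mono:
  assumes "exponentially_decaying d" "\<And>t. 0 \<le> t \<Longrightarrow> d' t \<le> d t"
  shows "exponentially_decaying d'"
  using assms unfolding exponentially_decaying_def by (meson order_trans)

locale network =
  fixes n r p m q :: nat and ms qs :: "nat \<Rightarrow> nat" and A B F a :: "real mat" and E :: "nat set set"
  assumes m: "m = (\<Sum>i<n. ms i)" and q: "q = (\<Sum>i<n. qs i)"
    and A: "A \<in> carrier_mat m r" and B: "B \<in> carrier_mat p q" and F: "F \<in> carrier_mat m q"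
    and graph: "undirected_graph {..<n} E" and weights: "weighted_adjacency_matrix n E a"
    and connected: "connected_graph {..<n} E"
begin

sublocale symmetric_weights n a
proof
  fix i j assume "i < n" "j < n"
  then have "a $$ (i, j) = a $$ (j, i)"
    "if {j, i} \<in> E then a $$ (i, j) > 0 else a $$ (i, j) = 0"
    using weights unfolding weighted_adjacency_matrix_def by blast+
  then show "a $$ (i, j) = a $$ (j, i)" "0 \<le> a $$ (i, j)"
    by (auto split: if_splits)
qed

lemma dim_a: "dim_row a = n"
  using weights unfolding weighted_adjacency_matrix_def by auto

lemma n_pos: "0 < n"
  using connected unfolding connected_graph_def by auto

text \<open>The kernel equation gives equality across an edge; connectivity propagates it along a
  path by induction.\<close>

lemma consensus:
  assumes x: "laplacian n d e a x = 0" and "i < n" "j < n" and kl: "k < d" "l < e"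
  shows "lookup x (i, k, l) = lookup x (j, k, l)"
proof -
  \<comment> \<open>Membership in \<open>E\<close> bounds both end points by \<open>n\<close> and
    makes the weight positive.\<close>
  have edge: "i < n \<and> j < n \<and> 0 < a $$ (i, j)" if "{i, j} \<in> E" for i j
  proof -
    have ij: "i < n" "j < n"
      using graph that unfolding undirected_graph_def by (auto simp: doubleton_eq_iff)
    then have "if {j, i} \<in> E then a $$ (i, j) > 0 else a $$ (i, j) = 0"
      using weights unfolding weighted_adjacency_matrix_def by blast
    with ij that show ?thesis
      by (simp add: insert_commute)
  qed
  have "(i, j) \<in> {(x, y). {x, y} \<in> E}\<^sup>*"
    using connected assms(2,3) unfolding connected_graph_def by blast
  then show ?thesis
  proof induction
    case (step j h)
    then have "{j, h} \<in> E"
      by simp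
    then show ?case
      using step.IH laplacian_kernel[OF x _ _ _ kl] edge by metis
  qed simp
qed

section \<open>The network as a consensus-constrained least squares problem\<close>

abbreviation "Av \<equiv> row_block ms A"
abbreviation "Bl \<equiv> col_block qs B"
abbreviation "Fl \<equiv> col_block qs F"
abbreviation "IR \<equiv> id_row_block n ms"

lemma block_carriers [simp]:
  "Av i \<in> carrier_mat (ms i) r" "Bl i \<in> carrier_mat p (qs i)" "Fl i \<in> carrier_mat m (qs i)"
  "IR i \<in> carrier_mat m (ms i)"
  using A B F by (auto simp: row_block_def col_block_def id_row_block_def m)

text \<open>Under consensus \<open>R x = S y\<close> reads \<open>A * X = Y\<close> one row-block at
  a time, and \<open>C y - f\<close> consists of the column-blocks of
  \<open>Y * B - F\<close>.\<close>

definition "R = left_mult n ms (\<lambda>_. r) p Av"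
definition "R' = left_mult n (\<lambda>_. r) ms p (\<lambda>i. transpose_mat (Av i))"
definition "S = left_mult n ms (\<lambda>_. m) p (\<lambda>i. transpose_mat (IR i))"
definition "S' = left_mult n (\<lambda>_. m) ms p IR"
definition "C = right_mult n m (\<lambda>_. p) qs Bl"
definition "C' = right_mult n m qs (\<lambda>_. p) (\<lambda>i. transpose_mat (Bl i))"
definition "Lx = laplacian n r p a"
definition "Ly = laplacian n m p a"
definition "f = stack n (\<lambda>_. m) qs Fl"

sublocale consensus_flow R R' S S' C C' Lx Ly f
proof (intro consensus_flow.intro consensus_flow_axioms.intro)
  show "finite_rank_adjoint R R'"
    unfolding R_def R'_def by (rule finite_rank_adjoint_left_mult) simp
  show "finite_rank_adjoint R' R"
    unfolding R_def R'_def by (rule finite_rank_adjoint_left_mult_transpose) simp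
  show "finite_rank_adjoint S S'"
    unfolding S_def S'_def by (rule finite_rank_adjoint_left_mult_transpose) simp
  show "finite_rank_adjoint S' S"
    unfolding S_def S'_def by (rule finite_rank_adjoint_left_mult) simp
  show "finite_rank_adjoint C C'"
    unfolding C_def C'_def by (rule finite_rank_adjoint_right_mult) simp
  show "finite_rank_adjoint C' C"
    unfolding C_def C'_def by (rule finite_rank_adjoint_right_mult_transpose) simp
qed (simp_all add: Lx_def Ly_def finite_rank_adjoint_laplacian laplacian_psd)

section \<open>Embedding of network states and of the vector field\<close>

abbreviation "stackX \<equiv> stack n (\<lambda>_. r) (\<lambda>_. p)"
abbreviation "stackY \<equiv> stack n (\<lambda>_. m) (\<lambda>_. p)"
abbreviation "stackL \<equiv> stack n ms (\<lambda>_. p)"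

type_synonym product_state = "(family \<times> family) \<times> (family \<times> family \<times> family)"

text \<open>On \<open>\<S>\<close> this preserves norms and differences. Members with index
  \<open>n\<close> or more are discarded, so equal images only identify the observed
  members.\<close>

definition emb :: "net_state \<Rightarrow> product_state" where
  "emb s = ((stackX (sX s), stackY (sY s)), (stackX (sL1 s), stackY (sL2 s), stackL (sL3 s)))"

abbreviation "\<S> \<equiv> states n ms r p"
abbreviation "vf \<equiv> vector_field n ms qs A B F a"

lemma states_iff:
  "s \<in> \<S> \<longleftrightarrow> (\<forall>i<n. sX s i \<in> carrier_mat r p \<and> sY s i \<in> carrier_mat m p \<and>
     sL1 s i \<in> carrier_mat r p \<and> sL2 s i \<in> carrier_mat m p \<and> sL3 s i \<in> carrier_mat (ms i) p)"
  by (simp add: states_def m)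

lemma coupling_carrier: "Z i \<in> carrier_mat d e \<Longrightarrow> coupling a Z i \<in> carrier_mat d e"
  by (auto simp: coupling_def)

lemma row_block_carrier: "Z \<in> carrier_mat d e \<Longrightarrow> row_block ms Z i \<in> carrier_mat (ms i) e"
  by (auto simp: row_block_def)

lemma R_stack:
  assumes "\<And>i. i < n \<Longrightarrow> X i \<in> carrier_mat r p"
  shows "stackL (\<lambda>i. Av i * X i) = R (stackX X)"
  unfolding R_def by (rule left_mult_stack[symmetric]) (use assms in auto)

lemma R'_stack:
  assumes "\<And>i. i < n \<Longrightarrow> Z i \<in> carrier_mat (ms i) p"
  shows "stackX (\<lambda>i. transpose_mat (Av i) * Z i) = R' (stackL Z)"
  unfolding R'_def by (rule left_mult_stack[symmetric]) (use assms in auto)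

lemma S_stack:
  assumes "\<And>i. i < n \<Longrightarrow> Y i \<in> carrier_mat m p"
  shows "stackL (\<lambda>i. row_block ms (Y i) i) = S (stackY Y)"
proof -
  have "stackL (\<lambda>i. row_block ms (Y i) i) = stackL (\<lambda>i. transpose_mat (IR i) * Y i)"
    by (rule stack_cong) (use assms in \<open>simp add: id_row_block_transpose_mult[where p = p] m\<close>)
  also have "\<dots> = S (stackY Y)"
    unfolding S_def by (rule left_mult_stack[symmetric]) (use assms in auto)
  finally show ?thesis .
qed

lemma S'_stack:
  assumes "\<And>i. i < n \<Longrightarrow> Z i \<in> carrier_mat (ms i) p"
  shows "stackY (\<lambda>i. IR i * Z i) = S' (stackL Z)"
  unfolding S'_def by (rule left_mult_stack[symmetric]) (use assms in auto)

lemma C_stack: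
  assumes "\<And>i. i < n \<Longrightarrow> Y i \<in> carrier_mat m p"
  shows "stack n (\<lambda>_. m) qs (\<lambda>i. Y i * Bl i) = C (stackY Y)"
  unfolding C_def by (rule right_mult_stack[symmetric]) (use assms in auto)

lemma C'_stack:
  assumes "\<And>i. i < n \<Longrightarrow> Z i \<in> carrier_mat m (qs i)"
  shows "stackY (\<lambda>i. Z i * transpose_mat (Bl i)) = C' (stack n (\<lambda>_. m) qs Z)"
  unfolding C'_def by (rule right_mult_stack[symmetric]) (use assms in auto)

lemma Lx_stack:
  assumes "\<And>i. i < n \<Longrightarrow> X i \<in> carrier_mat r p"
  shows "stackX (coupling a X) = Lx (stackX X)"
  unfolding Lx_def by (rule laplacian_stack[symmetric]) (use assms dim_a in auto)

lemma Ly_stack: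
  assumes "\<And>i. i < n \<Longrightarrow> Y i \<in> carrier_mat m p"
  shows "stackY (coupling a Y) = Ly (stackY Y)"
  unfolding Ly_def by (rule laplacian_stack[symmetric]) (use assms dim_a in auto)

text \<open>Stacking is additive and intertwines each matrix operation with its operator, so the
  field becomes the saddle-point field term by term.\<close>

lemma vector_field_in_states_emb:
  assumes s: "s \<in> \<S>"
  shows "vf s \<in> \<S>" "emb (vf s) = M (emb s) + ((0, C' f), 0)"
proof -
  define X Y L1 L2 L3 where "X = sX s" and "Y = sY s" and "L1 = sL1 s" and "L2 = sL2 s" and "L3 = sL3 s"
  define res where "res = (\<lambda>i. Av i * X i - row_block ms (Y i) i)"
  have vf: "vf s =
      \<lparr> sX = (\<lambda>i. - (transpose_mat (Av i) * res i) - transpose_mat (Av i) * L3 i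
               - coupling a L1 i - coupling a X i),
        sY = (\<lambda>i. - ((Y i * Bl i - Fl i) * transpose_mat (Bl i)) + IR i * L3 i
               + IR i * res i - coupling a Y i - coupling a L2 i),
        sL1 = (\<lambda>i. coupling a X i), sL2 = (\<lambda>i. coupling a Y i), sL3 = res \<rparr>"
    unfolding vector_field_def Let_def res_def X_def Y_def L1_def L2_def L3_def ..
  have X: "X i \<in> carrier_mat r p" and Y: "Y i \<in> carrier_mat m p"
    and L1: "L1 i \<in> carrier_mat r p" and L2: "L2 i \<in> carrier_mat m p"
    and L3: "L3 i \<in> carrier_mat (ms i) p" if "i < n" for i
    using s that by (auto simp: states_iff X_def Y_def L1_def L2_def L3_def)
  have res: "res i \<in> carrier_mat (ms i) p" if "i < n" for i
    unfolding res_def by (rule minus_carrier_mat) (rule row_block_carrier[OF Y[OF that]])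
  have AT: "transpose_mat (Av i) * Z \<in> carrier_mat r p" if "Z \<in> carrier_mat (ms i) p" for i Z
    by (rule mult_carrier_mat[OF _ that]) simp
  have IR: "IR i * Z \<in> carrier_mat m p" if "Z \<in> carrier_mat (ms i) p" for i Z
    by (rule mult_carrier_mat[OF _ that]) simp
  \<comment> \<open>A difference of matrices takes its dimensions from the subtrahend, here
    \<open>Fl i\<close>.\<close>
  have YBF: "Y i * Bl i - Fl i \<in> carrier_mat m (qs i)" for i
    by (rule minus_carrier_mat) simp
  have BT: "(Y i * Bl i - Fl i) * transpose_mat (Bl i) \<in> carrier_mat m p" for i
    by (rule mult_carrier_mat[OF YBF]) simp
  show "vf s \<in> \<S>"
    unfolding states_iff vf using X Y L1 L2 L3 res
    by (simp add: coupling_carrier minus_carrier_mat)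
  have res_stack: "stackL res = G (stackX X, stackY Y)"
  proof -
    have "stackL res = stackL (\<lambda>i. Av i * X i) - stackL (\<lambda>i. row_block ms (Y i) i)"
      unfolding res_def by (rule stack_diff) (rule row_block_carrier[OF Y])
    then show ?thesis
      by (simp add: G_def R_stack[OF X] S_stack[OF Y])
  qed
  have "stackX (sX (vf s)) = - stackX (\<lambda>i. transpose_mat (Av i) * res i)
      - stackX (\<lambda>i. transpose_mat (Av i) * L3 i) - stackX (coupling a L1) - stackX (coupling a X)"
    unfolding vf net_state.simps
    \<comment> \<open>The outermost difference is split first; each such split asks only for the
      dimensions of the second operand.\<close>
    apply (subst stack_diff, use X coupling_carrier in simp)
    apply (subst stack_diff, use L1 coupling_carrier in simp)
    apply (subst stack_diff, use L3 AT in simp)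
    apply (subst stack_uminus, use res AT in simp)
    by simp
  then have 1: "stackX (sX (vf s)) = - R' (stackL res) - R' (stackL L3) - Lx (stackX L1) - Lx (stackX X)"
    by (simp only: R'_stack[OF res] R'_stack[OF L3] Lx_stack[OF L1] Lx_stack[OF X])
  have "stackY (sY (vf s)) = - stackY (\<lambda>i. (Y i * Bl i - Fl i) * transpose_mat (Bl i))
      + stackY (\<lambda>i. IR i * L3 i) + stackY (\<lambda>i. IR i * res i)
      - stackY (coupling a Y) - stackY (coupling a L2)"
    unfolding vf net_state.simps
    apply (subst stack_diff, use L2 coupling_carrier in simp)
    apply (subst stack_diff, use Y coupling_carrier in simp)
    apply (subst stack_add, use res IR in simp)
    apply (subst stack_add, use L3 IR in simp)
    apply (subst stack_uminus, use BT in simp)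
    by simp
  moreover have "stackY (\<lambda>i. (Y i * Bl i - Fl i) * transpose_mat (Bl i)) = C' (C (stackY Y) - f)"
  proof -
    have "stack n (\<lambda>_. m) qs (\<lambda>i. Y i * Bl i - Fl i) = stack n (\<lambda>_. m) qs (\<lambda>i. Y i * Bl i) - f"
      unfolding f_def by (rule stack_diff) simp
    then have "stack n (\<lambda>_. m) qs (\<lambda>i. Y i * Bl i - Fl i) = C (stackY Y) - f"
      by (simp only: C_stack[OF Y])
    then show ?thesis
      by (simp only: C'_stack[OF YBF])
  qed
  ultimately have 2: "stackY (sY (vf s)) = - C' (C (stackY Y) - f) + S' (stackL L3) + S' (stackL res)
      - Ly (stackY Y) - Ly (stackY L2)"
    by (simp only: S'_stack[OF res] S'_stack[OF L3] Ly_stack[OF Y] Ly_stack[OF L2])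
  have 3: "stackX (sL1 (vf s)) = Lx (stackX X)" "stackY (sL2 (vf s)) = Ly (stackY Y)"
    "stackL (sL3 (vf s)) = stackL res"
    using Lx_stack[OF X] Ly_stack[OF Y] by (simp_all add: vf)
  \<comment> \<open>Linearity of \<open>C'\<close> splits off the constant term \<open>C' f\<close>;
    all else is linear in the state.\<close>
  show "emb (vf s) = M (emb s) + ((0, C' f), 0)"
    unfolding emb_def 1 2 3 res_stack X_def[symmetric] Y_def[symmetric] L1_def[symmetric]
      L2_def[symmetric] L3_def[symmetric]
    by (simp add: M_def H_def K_def Kt_def linear_diff[OF C'.linear] zero_prod_def algebra_simps)
qed

section \<open>Equilibria, distances and solutions under the embedding\<close>

lemma emb_eq_0_iff:
  assumes "s \<in> \<S>"
  shows "emb s = 0 \<longleftrightarrow> (\<forall>i<n. sX s i = 0\<^sub>m r p \<and> sY s i = 0\<^sub>m m p \<and>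
     sL1 s i = 0\<^sub>m r p \<and> sL2 s i = 0\<^sub>m m p \<and> sL3 s i = 0\<^sub>m (ms i) p)"
proof -
  note c = assms[unfolded states_iff]
  have "stackX (sX s) = 0 \<longleftrightarrow> (\<forall>i<n. sX s i = 0\<^sub>m r p)" "stackY (sY s) = 0 \<longleftrightarrow> (\<forall>i<n. sY s i = 0\<^sub>m m p)"
    "stackX (sL1 s) = 0 \<longleftrightarrow> (\<forall>i<n. sL1 s i = 0\<^sub>m r p)" "stackY (sL2 s) = 0 \<longleftrightarrow> (\<forall>i<n. sL2 s i = 0\<^sub>m m p)"
    "stackL (sL3 s) = 0 \<longleftrightarrow> (\<forall>i<n. sL3 s i = 0\<^sub>m (ms i) p)"
    by (rule stack_eq_0_iff, use c in blast)+
  then show ?thesis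
    unfolding emb_def zero_prod_def by blast
qed

lemma is_equilibrium_iff:
  "is_equilibrium n \<S> vf z \<longleftrightarrow> z \<in> \<S> \<and> equilibrium (emb z)"
proof (cases "z \<in> \<S>")
  case True
  have "is_equilibrium n \<S> vf z \<longleftrightarrow> (\<forall>i<n. sX (vf z) i = 0\<^sub>m r p \<and> sY (vf z) i = 0\<^sub>m m p \<and>
      sL1 (vf z) i = 0\<^sub>m r p \<and> sL2 (vf z) i = 0\<^sub>m m p \<and> sL3 (vf z) i = 0\<^sub>m (ms i) p)"
    unfolding is_equilibrium_def
    using True by (auto simp: states_iff zero_mat_like_def)
  also have "\<dots> \<longleftrightarrow> emb (vf z) = 0"
    using emb_eq_0_iff[OF vector_field_in_states_emb(1)[OF True]] by simp
  finally show ?thesis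
    by (simp add: equilibrium_def vector_field_in_states_emb(2)[OF True] True)
qed (simp add: is_equilibrium_def)

lemma state_norm_emb:
  assumes "s \<in> \<S>"
  shows "state_norm n s = norm (emb s)"
proof -
  note c = assms[unfolded states_iff]
  have "(norm (stackX (sX s)))\<^sup>2 = (\<Sum>i<n. (frobenius_norm (sX s i))\<^sup>2)"
    "(norm (stackY (sY s)))\<^sup>2 = (\<Sum>i<n. (frobenius_norm (sY s i))\<^sup>2)"
    "(norm (stackX (sL1 s)))\<^sup>2 = (\<Sum>i<n. (frobenius_norm (sL1 s i))\<^sup>2)"
    "(norm (stackY (sL2 s)))\<^sup>2 = (\<Sum>i<n. (frobenius_norm (sL2 s i))\<^sup>2)"
    "(norm (stackL (sL3 s)))\<^sup>2 = (\<Sum>i<n. (frobenius_norm (sL3 s i))\<^sup>2)"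
    by (rule norm_stack_square, use c in blast)+
  then show ?thesis
    by (simp add: state_norm_def emb_def norm_prod_def sum.distrib sum_nonneg add.assoc)
qed

lemma state_diff_in_states_emb:
  assumes "s' \<in> \<S>"
  shows "state_diff s s' \<in> \<S>" "emb (state_diff s s') = emb s - emb s'"
proof -
  note c = assms[unfolded states_iff]
  show "state_diff s s' \<in> \<S>"
    using c by (simp add: states_iff state_diff_def minus_carrier_mat)
  have "stackX (\<lambda>i. sX s i - sX s' i) = stackX (sX s) - stackX (sX s')"
    "stackY (\<lambda>i. sY s i - sY s' i) = stackY (sY s) - stackY (sY s')"
    "stackX (\<lambda>i. sL1 s i - sL1 s' i) = stackX (sL1 s) - stackX (sL1 s')"
    "stackY (\<lambda>i. sL2 s i - sL2 s' i) = stackY (sL2 s) - stackY (sL2 s')"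
    "stackL (\<lambda>i. sL3 s i - sL3 s' i) = stackL (sL3 s) - stackL (sL3 s')"
    by (rule stack_diff, use c in blast)+
  then show "emb (state_diff s s') = emb s - emb s'"
    by (simp add: emb_def state_diff_def)
qed

lemma state_dist_emb: "s' \<in> \<S> \<Longrightarrow> state_dist n s s' = norm (emb s - emb s')"
  by (simp add: state_dist_def state_norm_emb state_diff_in_states_emb)

lemma solution_emb:
  assumes "is_solution n \<S> vf x"
  shows "solution (\<lambda>t. emb (x t))"
  unfolding solution_def
proof (intro allI impI)
  fix t :: real assume t: "0 \<le> t"
  have xt: "x t \<in> \<S>"
    using assms t unfolding is_solution_def by blast
  note c = vector_field_in_states_emb(1)[OF xt, unfolded states_iff]
  note d = assms[unfolded is_solution_def, THEN conjunct2, rule_format, OF t]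
  have "((\<lambda>\<tau>. stackX (sX (x \<tau>))) has_vector_derivative stackX (sX (vf (x t)))) (at t within {0..})"
    "((\<lambda>\<tau>. stackY (sY (x \<tau>))) has_vector_derivative stackY (sY (vf (x t)))) (at t within {0..})"
    "((\<lambda>\<tau>. stackX (sL1 (x \<tau>))) has_vector_derivative stackX (sL1 (vf (x t)))) (at t within {0..})"
    "((\<lambda>\<tau>. stackY (sL2 (x \<tau>))) has_vector_derivative stackY (sL2 (vf (x t)))) (at t within {0..})"
    "((\<lambda>\<tau>. stackL (sL3 (x \<tau>))) has_vector_derivative stackL (sL3 (vf (x t)))) (at t within {0..})"
    by (rule stack_has_vector_derivative, use c d in blast, use c in blast)+
  then have "((\<lambda>\<tau>. emb (x \<tau>)) has_vector_derivative emb (vf (x t))) (at t within {0..})"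
    unfolding emb_def by (intro has_vector_derivative_Pair)
  then show "((\<lambda>t. emb (x t)) has_vector_derivative M (emb (x t)) + ((0, C' f), 0)) (at t within {0..})"
    by (simp only: vector_field_in_states_emb(2)[OF xt])
qed

text \<open>A point of the abstract space need not come from matrices. This one differs from
  \<open>emb s\<close> by a value of \<open>M\<close>, whose operators write only inside the cells,
  so unstacking recovers a state.\<close>

lemma equilibrium_is_emb:
  assumes "emb s - e \<in> range M"
  shows "\<exists>z\<in>\<S>. emb z = e"
proof -
  obtain u where "emb s - e = M u"
    using assms by blast
  then have e: "e = emb s - M u"
    by (simp add: algebra_simps)
  define z where "z = \<lparr> sX = unstack (\<lambda>_. r) (\<lambda>_. p) (fst (fst e)),
    sY = unstack (\<lambda>_. m) (\<lambda>_. p) (snd (fst e)), sL1 = unstack (\<lambda>_. r) (\<lambda>_. p) (fst (snd e)),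
    sL2 = unstack (\<lambda>_. m) (\<lambda>_. p) (fst (snd (snd e))), sL3 = unstack ms (\<lambda>_. p) (snd (snd (snd e))) \<rparr>"
  have "z \<in> \<S>"
    using unstack_carrier[of "\<lambda>_. r" "\<lambda>_. p"] unstack_carrier[of "\<lambda>_. m" "\<lambda>_. p"]
      unstack_carrier[of ms "\<lambda>_. p"] by (simp add: states_iff z_def)
  moreover have "emb z = e"
  proof -
    have ops: "c \<notin> cells n ms (\<lambda>_. p) \<Longrightarrow> lookup (R x) c = 0"
      "c \<notin> cells n (\<lambda>_. r) (\<lambda>_. p) \<Longrightarrow> lookup (R' g) c = 0"
      "c \<notin> cells n ms (\<lambda>_. p) \<Longrightarrow> lookup (S y) c = 0"
      "c \<notin> cells n (\<lambda>_. m) (\<lambda>_. p) \<Longrightarrow> lookup (S' g) c = 0"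
      "c \<notin> cells n (\<lambda>_. m) (\<lambda>_. p) \<Longrightarrow> lookup (C' h) c = 0"
      "c \<notin> cells n (\<lambda>_. r) (\<lambda>_. p) \<Longrightarrow> lookup (Lx x) c = 0"
      "c \<notin> cells n (\<lambda>_. m) (\<lambda>_. p) \<Longrightarrow> lookup (Ly y) c = 0" for c x y g h
      unfolding R_def R'_def S_def S'_def C'_def Lx_def Ly_def
      by (simp_all add: lookup_outside_cells lookup_laplacian_outside_cells)
    note outside = e emb_def M_def H_def K_def Kt_def G_def lookup_minus lookup_add
      lookup_outside_cells ops
    have "stackX (unstack (\<lambda>_. r) (\<lambda>_. p) (fst (fst e))) = fst (fst e)"
      by (rule stack_unstack) (simp add: outside)
    moreover have "stackY (unstack (\<lambda>_. m) (\<lambda>_. p) (snd (fst e))) = snd (fst e)"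
      by (rule stack_unstack) (simp add: outside)
    moreover have "stackX (unstack (\<lambda>_. r) (\<lambda>_. p) (fst (snd e))) = fst (snd e)"
      by (rule stack_unstack) (simp add: outside)
    moreover have "stackY (unstack (\<lambda>_. m) (\<lambda>_. p) (fst (snd (snd e)))) = fst (snd (snd e))"
      by (rule stack_unstack) (simp add: outside)
    moreover have "stackL (unstack ms (\<lambda>_. p) (snd (snd (snd e)))) = snd (snd (snd e))"
      by (rule stack_unstack) (simp add: outside)
    ultimately show ?thesis
      by (simp add: emb_def z_def)
  qed
  ultimately show ?thesis by blast
qed

section \<open>Equilibria solve the least squares problem\<close>

lemma residual_norm:
  assumes Y: "Y \<in> carrier_mat m p"
  shows "(norm (C (stackY (\<lambda>_. Y)) - f))\<^sup>2 = (frobenius_norm (Y * B - F))\<^sup>2"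
proof -
  have "C (stackY (\<lambda>_. Y)) - f = stack n (\<lambda>_. m) qs (\<lambda>i. Y * Bl i - Fl i)"
    unfolding f_def C_stack[OF Y, symmetric] by (rule stack_diff[symmetric]) simp
  also have "(norm \<dots>)\<^sup>2 = (\<Sum>i<n. (frobenius_norm (Y * Bl i - Fl i))\<^sup>2)"
    by (rule norm_stack_square) (rule minus_carrier_mat, simp)
  \<comment> \<open>The agents' residuals are the column-blocks of one matrix, over which squared
    Frobenius norms add up.\<close>
  also have "\<dots> = (\<Sum>i<n. (frobenius_norm (col_block qs (Y * B - F) i))\<^sup>2)"
    using Y B F by (intro sum.cong) (auto simp: col_block_mult_diff[where m = m and p = p and n = n] q)
  also have "\<dots> = (frobenius_norm (Y * B - F))\<^sup>2"
    using F by (intro frobenius_norm_col_blocks) (simp add: q)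
  finally show ?thesis .
qed

text \<open>Feasibility gives common values \<open>X\<close> and \<open>Y\<close>, represented by
  agent 0, which exists as the graph is nonempty. Its row-blocks give \<open>A * X = Y\<close>, and
  optimality is tested on constant families.\<close>

lemma equilibrium_least_squares:
  assumes z: "is_equilibrium n \<S> vf z"
  shows "least_squares_solution A B F (sX z 0)" and "i < n \<Longrightarrow> sX z i = sX z 0"
proof -
  have zS: "z \<in> \<S>" and eq: "equilibrium (emb z)"
    using z by (auto simp: is_equilibrium_iff)
  note c = zS[unfolded states_iff, rule_format]
  define X Y where "X = sX z 0" and "Y = sY z 0"
  have X: "X \<in> carrier_mat r p" and Y: "Y \<in> carrier_mat m p"
    using c[OF n_pos] by (auto simp: X_def Y_def)
  have feasible: "R (stackX (sX z)) = S (stackY (sY z))" "Lx (stackX (sX z)) = 0" "Ly (stackY (sY z)) = 0"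
    using equilibrium_feasible[OF eq] by (auto simp: emb_def)
  have sX: "sX z i = X" if i: "i < n" for i
  proof (rule eq_matI)
    fix k l assume "k < dim_row X" "l < dim_col X"
    then show "sX z i $$ (k, l) = X $$ (k, l)"
      using consensus[OF feasible(2)[unfolded Lx_def] i n_pos, of k l] X i n_pos
      by (simp add: lookup_stack X_def)
  qed (use c[OF i] X in auto)
  have sY: "sY z i = Y" if i: "i < n" for i
  proof (rule eq_matI)
    fix k l assume "k < dim_row Y" "l < dim_col Y"
    then show "sY z i $$ (k, l) = Y $$ (k, l)"
      using consensus[OF feasible(3)[unfolded Ly_def] i n_pos, of k l] Y i n_pos
      by (simp add: lookup_stack Y_def)
  qed (use c[OF i] Y in auto)
  show "i < n \<Longrightarrow> sX z i = sX z 0"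
    using sX unfolding X_def by blast
  have stack_sX: "stackX (sX z) = stackX (\<lambda>_. X)" and stack_sY: "stackY (sY z) = stackY (\<lambda>_. Y)"
    by (rule stack_cong, simp add: sX sY)+
  have "A * X = Y"
  proof (rule eq_if_row_blocks_eq)
    fix i assume i: "i < n"
    have "stackL (\<lambda>i. Av i * X) = stackL (\<lambda>i. row_block ms Y i)"
      using feasible(1) by (simp add: stack_sX stack_sY R_stack X S_stack Y)
    then have lookup_eq: "lookup (stackL (\<lambda>i. Av i * X)) (i, k, l) = lookup (stackL (\<lambda>i. row_block ms Y i)) (i, k, l)"
      for k l by simp
    have "Av i * X = row_block ms Y i"
    proof (rule eq_matI)
      show "(Av i * X) $$ (k, l) = row_block ms Y i $$ (k, l)"
        if "k < dim_row (row_block ms Y i)" "l < dim_col (row_block ms Y i)" for k l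
        using lookup_eq[of k l] that i Y by (simp add: lookup_stack row_block_def)
    qed (use X Y in \<open>auto simp: row_block_def\<close>)
    then show "row_block ms (A * X) i = row_block ms Y i"
      using row_block_mult[OF A[unfolded m] X i] by simp
  qed (use A X Y m in auto)
  have "(frobenius_norm (A * X * B - F))\<^sup>2 \<le> (frobenius_norm (A * Z * B - F))\<^sup>2"
    if Z: "Z \<in> carrier_mat r p" for Z
  proof -
    have AZ: "A * Z \<in> carrier_mat m p"
      using A Z by simp
    \<comment> \<open>Every competitor \<open>Z\<close> yields feasible constant families
      \<open>Z\<close> and \<open>A * Z\<close>, so constrained minimality implies minimality over
      all \<open>Z\<close>.\<close>
    have "R (stackX (\<lambda>_. Z)) = S (stackY (\<lambda>_. A * Z))"
      unfolding R_stack[OF Z, symmetric] S_stack[OF AZ, symmetric]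
      by (rule stack_cong) (simp add: row_block_mult[OF A[unfolded m] Z])
    then have "(norm (C (stackY (\<lambda>_. Y)) - f))\<^sup>2 \<le> (norm (C (stackY (\<lambda>_. A * Z)) - f))\<^sup>2"
      using equilibrium_optimal[OF eq, of "stackX (\<lambda>_. Z)" "stackY (\<lambda>_. A * Z)"]
      by (simp add: emb_def stack_sY Lx_def Ly_def laplacian_const)
    then show ?thesis
      by (simp add: residual_norm Y AZ \<open>A * X = Y\<close>)
  qed
  then show "least_squares_solution A B F (sX z 0)"
    using A B X unfolding least_squares_solution_def X_def by simp
qed

section \<open>Stability and convergence of network trajectories\<close>

lemma state_dist_solution_le:
  assumes "is_solution n \<S> vf x" "is_equilibrium n \<S> vf z" "0 \<le> t"
  shows "state_dist n (x t) z \<le> state_dist n (x 0) z"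
  using dist_equilibrium_decreasing[OF solution_emb[OF assms(1)] _ assms(3)] assms(2)
  by (simp add: is_equilibrium_iff state_dist_emb)

lemma frobenius_norm_sX_le:
  assumes "i < n"
  shows "frobenius_norm (sX s i - sX z i) \<le> state_dist n s z"
proof -
  let ?N = "\<lambda>i. (frobenius_norm (sX (state_diff s z) i))\<^sup>2 + (frobenius_norm (sY (state_diff s z) i))\<^sup>2 +
     (frobenius_norm (sL1 (state_diff s z) i))\<^sup>2 + (frobenius_norm (sL2 (state_diff s z) i))\<^sup>2 +
     (frobenius_norm (sL3 (state_diff s z) i))\<^sup>2"
  have "(frobenius_norm (sX s i - sX z i))\<^sup>2 \<le> ?N i"
    by (simp add: state_diff_def)
  also have "\<dots> \<le> (\<Sum>i<n. ?N i)"
    by (rule member_le_sum) (use assms in auto)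
  finally show ?thesis
    unfolding state_dist_def state_norm_def by (rule real_le_rsqrt)
qed

lemma solution_converges:
  assumes x: "is_solution n \<S> vf x"
  obtains z where "is_equilibrium n \<S> vf z" "exponentially_decaying (\<lambda>t. state_dist n (x t) z)"
proof -
  obtain e c \<mu> where e: "equilibrium e" "emb (x 0) - e \<in> range M"
    and conv: "0 \<le> c" "0 < \<mu>" "\<And>t. 0 \<le> t \<Longrightarrow> norm (emb (x t) - e) \<le> c * exp (- \<mu> * t)"
    using exponential_convergence[OF solution_emb[OF x]] by blast
  obtain z where z: "z \<in> \<S>" "emb z = e"
    using equilibrium_is_emb[OF e(2)] by blast
  show ?thesis
  proof
    show "is_equilibrium n \<S> vf z"
      using z e(1) by (simp add: is_equilibrium_iff)
    show "exponentially_decaying (\<lambda>t. state_dist n (x t) z)"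
      using conv by (auto simp: exponentially_decaying_def state_dist_emb z)
  qed
qed

end

theorem mainTheorem3:
  fixes n r p m q :: nat
    and ms qs :: "nat \<Rightarrow> nat"
    and A B F a :: "real mat"
    and E :: "nat set set"
  defines "S \<equiv> states n ms r p"
    and "f \<equiv> vector_field n ms qs A B F a"
  assumes "m = (\<Sum>i<n. ms i)" and "q = (\<Sum>i<n. qs i)"
    and "A \<in> carrier_mat m r" and "B \<in> carrier_mat p q" and "F \<in> carrier_mat m q"
    and "undirected_graph {..<n} E" and "weighted_adjacency_matrix n E a"
    and "connected_graph {..<n} E"
  shows "(\<forall>z. is_equilibrium n S f z \<longrightarrow> lyapunov_stable n S f z) \<and>
         (\<forall>x. is_solution n S f x \<longrightarrow> bounded_trajectory n x) \<and>
         (\<forall>x. is_solution n S f x \<longrightarrow>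
            exponentially_convergent n S f x \<and>
            (\<exists>X. least_squares_solution A B F X \<and>
               (\<forall>i<n. exponentially_decaying (\<lambda>t. frobenius_norm (sX (x t) i - X)))))"
proof -
  interpret N: network n r p m q ms qs A B F a E
    by (rule network.intro) (fact assms)+
  have "lyapunov_stable n S f z" if z: "is_equilibrium n S f z" for z
    unfolding lyapunov_stable_def
  proof (intro allI impI)
    fix \<epsilon> :: real assume "0 < \<epsilon>"
    \<comment> \<open>Distances to an equilibrium do not increase, so
      \<open>\<delta> = \<epsilon>\<close> works.\<close>
    then show "\<exists>\<delta>>0. \<forall>x. is_solution n S f x \<and> state_dist n (x 0) z < \<delta> \<longrightarrow>
        (\<forall>t\<ge>0. state_dist n (x t) z < \<epsilon>)"
      using N.state_dist_solution_le[OF _ z[unfolded S_def f_def]]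
      unfolding S_def f_def by (meson le_less_trans)
  qed
  moreover have "bounded_trajectory n x" if x: "is_solution n S f x" for x
  proof -
    \<comment> \<open>The limit of the trajectory itself supplies an equilibrium to compare
      with.\<close>
    obtain z where z: "is_equilibrium n S f z"
      using N.solution_converges[OF x[unfolded S_def f_def]] unfolding S_def f_def by blast
    have "state_norm n (x t) \<le> state_dist n (x 0) z + state_norm n z" if t: "0 \<le> t" for t
    proof -
      have xt: "x t \<in> states n ms r p" and zS: "z \<in> states n ms r p"
        using x z t by (auto simp: is_solution_def is_equilibrium_def S_def)
      have "norm (N.emb (x t)) \<le> norm (N.emb (x t) - N.emb z) + norm (N.emb z)"
        by (metis diff_add_cancel norm_triangle_ineq)
      then have "state_norm n (x t) \<le> state_dist n (x t) z + state_norm n z"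
        by (simp add: N.state_norm_emb N.state_dist_emb xt zS)
      then show ?thesis
        using N.state_dist_solution_le[OF x[unfolded S_def f_def] z[unfolded S_def f_def] t] by simp
    qed
    then show ?thesis
      unfolding bounded_trajectory_def by blast
  qed
  moreover have "exponentially_convergent n S f x \<and> (\<exists>X. least_squares_solution A B F X \<and>
      (\<forall>i<n. exponentially_decaying (\<lambda>t. frobenius_norm (sX (x t) i - X))))"
    if x: "is_solution n S f x" for x
  proof -
    obtain z where z: "is_equilibrium n S f z" and conv: "exponentially_decaying (\<lambda>t. state_dist n (x t) z)"
      using N.solution_converges[OF x[unfolded S_def f_def]] unfolding S_def f_def by blast
    \<comment> \<open>At the limit all \<open>sX z i\<close> agree with \<open>sX z 0\<close>, so
      one least squares solution serves all agents.\<close>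
    have "exponentially_decaying (\<lambda>t. frobenius_norm (sX (x t) i - sX z 0))" if i: "i < n" for i
      using exponentially_decaying_mono[OF conv N.frobenius_norm_sX_le[OF i]]
        N.equilibrium_least_squares(2)[OF z[unfolded S_def f_def] i] by simp
    then show ?thesis
      using z conv N.equilibrium_least_squares(1)[OF z[unfolded S_def f_def]]
      unfolding exponentially_convergent_def by blast
  qed
  ultimately show ?thesis
    by blast
qed

end
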